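(* Let $G$ be a finite group and $S$ a generating set for $G$. Then there exist a $3$-connected cubic undirected graph $D_{G,S}$ and a cycle double cover $\mathcal{Z}$ of $D_{G,S}$ satisfying the following properties: (1) $\mathrm{Aut}(D_{G,S}) \cong G$; (2) $\mathcal{Z}$ describes a polyhedral map; and (3) $\{\pi(z)\mid z\in \mathcal{Z},\ \pi\in\mathrm{Aut}(D_{G,S})\}=\mathcal{Z}$, i.e. $\mathcal{Z}$ is $\mathrm{Aut}(D_{G,S})$-invariant.
   Context: All graphs are connected, simple and finite. A cycle of an undirected graph $\Gamma$ is a connected 2-regular subgraph of $\Gamma$. A cycle double cover (CDC) of $\Gamma$ is a set of cycles in $\Gamma$ such that every edge of $\Gamma$ is contained in exactly two of these cycles. A CDC of a cubic graph describes (induces) a polyhedral map if any two distinct cycles of the CDC have at most one edge in common. $\mathrm{Aut}(\Gamma)$ denotes the group of graph automorphisms of $\Gamma$; an automorphism $\pi$ acts on edges by $\pi(\{v,w\})=\{\pi(v),\pi(w)\}$ and hence on cycles. *)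

theory Defs
  imports
    "HOL-Algebra.Bij"
    "HOL-Algebra.Generated_Groups"
    "Graph_Theory.Graph_Theory"
begin

text \<open>
  An undirected finite simple graph is a \<^locale>\<open>pair_graph\<close>: a finite, loop-free digraph
  whose set of arcs (ordered pairs of vertices) is symmetric.  The undirected edges are the
  two-element sets \<open>{u, v}\<close> underlying the arcs.
\<close>

definition uedges :: "'v pair_pre_digraph \<Rightarrow> 'v set set" where
  "uedges D = (\<lambda>(u, v). {u, v}) ` parcs D"

text \<open>In a symmetric digraph without parallel arcs, the out-degree of a vertex is its degree.\<close>

definition regular_graph :: "nat \<Rightarrow> 'v pair_pre_digraph \<Rightarrow> bool" where
  "regular_graph d D \<longleftrightarrow> (\<forall>v \<in> pverts D. out_degree (with_proj D) v = d)"

definition k_vertex_connected :: "nat \<Rightarrow> 'v pair_pre_digraph \<Rightarrow> bool" where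
  "k_vertex_connected k D \<longleftrightarrow>
     card (pverts D) > k \<and>
     (\<forall>X. X \<subseteq> pverts D \<and> card X < k \<longrightarrow>
        Digraph_Component.connected (with_proj D \<restriction> (pverts D - X)))"

text \<open>The library's \<open>pre_digraph.cycle\<close> is a closed walk, so it distinguishes starting points and
  directions, and it admits \<open>u, v, u\<close>.  Here a cycle is a connected 2-regular subgraph.\<close>

definition cycle_subgraph :: "'v pair_pre_digraph \<Rightarrow> 'v pair_pre_digraph \<Rightarrow> bool" where
  "cycle_subgraph C D \<longleftrightarrow>
     pair_graph C \<and> subgraph (with_proj C) (with_proj D) \<and>
     Digraph_Component.connected (with_proj C) \<and> regular_graph 2 C"

definition cycle_double_cover :: "'v pair_pre_digraph \<Rightarrow> 'v pair_pre_digraph set \<Rightarrow> bool" where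
  "cycle_double_cover D Z \<longleftrightarrow>
     (\<forall>C \<in> Z. cycle_subgraph C D) \<and>
     (\<forall>e \<in> uedges D. card {C \<in> Z. e \<in> uedges C} = 2)"

text \<open>To be used for a cycle double cover \<open>Z\<close> of a cubic graph.\<close>

definition describes_polyhedral_map :: "'v pair_pre_digraph set \<Rightarrow> bool" where
  "describes_polyhedral_map Z \<longleftrightarrow>
     (\<forall>C \<in> Z. \<forall>C' \<in> Z. C \<noteq> C' \<longrightarrow> card (uedges C \<inter> uedges C') \<le> 1)"

definition graph_auts :: "'v pair_pre_digraph \<Rightarrow> ('v \<Rightarrow> 'v) set" where
  "graph_auts D = {\<pi> \<in> Bij (pverts D).
     \<forall>u \<in> pverts D. \<forall>v \<in> pverts D. (\<pi> u, \<pi> v) \<in> parcs D \<longleftrightarrow> (u, v) \<in> parcs D}"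

definition Aut_graph :: "'v pair_pre_digraph \<Rightarrow> ('v \<Rightarrow> 'v) monoid" where
  "Aut_graph D = BijGroup (pverts D) \<lparr>carrier := graph_auts D\<rparr>"

definition graph_image :: "('v \<Rightarrow> 'w) \<Rightarrow> 'v pair_pre_digraph \<Rightarrow> 'w pair_pre_digraph" where
  "graph_image \<pi> C = \<lparr>pverts = \<pi> ` pverts C, parcs = map_prod \<pi> \<pi> ` parcs C\<rparr>"

end

theory Submission
  imports Defs
begin

text \<open>
  The dual of a cubic polyhedral map is a triangulated surface.  Start from a bipyramid over an
  \<open>(m + 1)\<close>-gon with one triangle stellarly subdivided twice; dually, this is a prism with one
  vertex replaced by a small gadget that contains the only triangle.  Give the rungs of the prism
  voltages such that every element of \<open>G\<close> occurs, always on two consecutive rungs.  The derived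
  graph of this voltage graph is cubic and connected, and \<open>G\<close> acts on it.  The connected components
  of the preimages of the faces form a cycle double cover.  A square between rungs of equal
  voltage lifts isomorphically, and of two adjacent faces at least one does, so two
  lifted faces share at most one edge.

  An automorphism preserves the triangles, and starting from them adjacency alone determines the
  base vertex below every vertex; so automorphisms are deck transformations.  Finally, a
  connected cubic graph with a polyhedral cycle double cover is 3-connected: a cycle crosses an
  edge cut an even number of times, so both cycles through an edge of a cut of size at most two
  would share a second edge.
\<close>

section \<open>Connectivity of cubic polyhedral maps\<close>

text \<open>Brings connectedness into the form in which it is used below, a statement about edge
  cuts. In the converse direction the vertices reachable from \<open>u\<close> would form a set
  without outgoing arcs.\<close>

lemma connected_iff_cut:
  assumes "parcs D \<subseteq> pverts D \<times> pverts D" and sym: "sym (parcs D)"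
  shows "Digraph_Component.connected (with_proj D) \<longleftrightarrow> pverts D \<noteq> {} \<and>
    (\<forall>A. A \<subseteq> pverts D \<longrightarrow> A \<noteq> {} \<longrightarrow> A \<noteq> pverts D \<longrightarrow> (\<exists>u v. (u, v) \<in> parcs D \<and> u \<in> A \<and> v \<notin> A))"
    (is "?l \<longleftrightarrow> ?ne \<and> ?cut")
proof -
  have symcl: "symcl (parcs D) = parcs D"
    using sym by (auto simp: symcl_def dest: symD)
  have conv: "?l \<longleftrightarrow> ?ne \<and> (\<forall>u \<in> pverts D. \<forall>v \<in> pverts D. (u, v) \<in> rtrancl_on (pverts D) (parcs D))"
    unfolding connected_conv by (simp add: symcl)
  show ?thesis
  proof
    assume ?l
    have "\<exists>u v. (u, v) \<in> parcs D \<and> u \<in> A \<and> v \<notin> A"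
      if A: "A \<subseteq> pverts D" "A \<noteq> {}" "A \<noteq> pverts D" for A
    proof (rule ccontr)
      assume closed: "\<not> ?thesis"
      obtain a b where a: "a \<in> A" and b: "b \<in> pverts D" "b \<notin> A" using A by blast
      with \<open>?l\<close> conv A have "(a, b) \<in> rtrancl_on (pverts D) (parcs D)" by blast
      then have "b \<in> A" using a by induct (use closed in blast)+
      with b show False by blast
    qed
    with \<open>?l\<close> conv show "?ne \<and> ?cut" by blast
  next
    assume r: "?ne \<and> ?cut"
    have "(u, v) \<in> rtrancl_on (pverts D) (parcs D)" if u: "u \<in> pverts D" and v: "v \<in> pverts D" for u v
    proof (rule ccontr)
      assume n: "\<not> ?thesis"
      let ?A = "{w. (u, w) \<in> rtrancl_on (pverts D) (parcs D)}"
      have "?A \<subseteq> pverts D" by (auto dest: in_rtrancl_on_in_F)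
      moreover have "u \<in> ?A" using u by simp
      moreover have "v \<notin> ?A" using n by simp
      ultimately obtain x y where "(x, y) \<in> parcs D" "x \<in> ?A" "y \<notin> ?A" using r v by blast
      then show False using assms(1) by (auto intro: rtrancl_on_into_rtrancl_on)
    qed
    with r conv show ?l by blast
  qed
qed

section \<open>Symmetric loop-free digraphs and their degrees\<close>

lemma pair_graphI:
  assumes "finite (pverts D)" "parcs D \<subseteq> pverts D \<times> pverts D" "sym (parcs D)"
    and "\<And>v. (v, v) \<notin> parcs D"
  shows "pair_graph D"
proof -
  have "finite (parcs D)" using assms finite_subset by blast
  with assms show ?thesis
    by unfold_locales (auto simp: symmetric_def)
qed

lemma pair_graphD:
  assumes "pair_graph D"
  shows "finite (pverts D)" "finite (parcs D)" "parcs D \<subseteq> pverts D \<times> pverts D" "sym (parcs D)"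
    and "(v, v) \<notin> parcs D"
proof -
  interpret pair_graph D by fact
  show "finite (pverts D)" "finite (parcs D)"
    by (simp_all add: pair_finite_verts pair_finite_arcs)
  show "parcs D \<subseteq> pverts D \<times> pverts D" using in_arcsD1 in_arcsD2 by auto
  show "sym (parcs D)" using pair_sym_arcs by (simp add: symmetric_def)
  show "(v, v) \<notin> parcs D" using pair_no_loops by fastforce
qed

lemma out_degree_eq_card_Image: "out_degree (with_proj D) v = card (parcs D `` {v})"
proof -
  have "out_arcs (with_proj D) v = Pair v ` (parcs D `` {v})"
    by (auto simp: out_arcs_def)
  then show ?thesis by (simp add: out_degree_def card_image inj_on_def)
qed

lemma restrict_with_proj:
  "with_proj D \<restriction> W = with_proj \<lparr>pverts = W, parcs = parcs D \<inter> W \<times> W\<rparr>"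
  by (auto simp: induce_subgraph_def with_proj_def)

section \<open>Parity and size of edge cuts\<close>

text \<open>Every arc pairs with its reverse. The linear order on the vertices selects one arc of
  each pair.\<close>

lemma even_card_sym_irrefl:
  fixes R :: "('v::linorder) rel"
  assumes "finite R" "sym R" "\<And>v. (v, v) \<notin> R"
  shows "even (card R)"
proof -
  let ?P = "{(u, v) \<in> R. u < v}"
  have R: "R = ?P \<union> prod.swap ` ?P"
  proof
    show "R \<subseteq> ?P \<union> prod.swap ` ?P"
    proof
      fix e assume e: "e \<in> R"
      obtain u v where uv: "e = (u, v)" by fastforce
      have "u < v \<or> v < u" using e uv assms(3) by (metis linorder_neqE)
      moreover have "(v, u) \<in> R" using assms(2) e uv by (auto dest: symD)
      ultimately show "e \<in> ?P \<union> prod.swap ` ?P" using e uv by force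
    qed
    show "?P \<union> prod.swap ` ?P \<subseteq> R" using assms(2) by (auto dest: symD)
  qed
  have fin: "finite ?P" by (rule finite_subset[OF _ assms(1)]) auto
  have "card R = card ?P + card (prod.swap ` ?P)"
    by (subst R, rule card_Un_disjoint) (use fin in auto)
  also have "card (prod.swap ` ?P) = card ?P" by (rule card_image) (auto simp: inj_on_def)
  finally show ?thesis by simp
qed

text \<open>Handshake argument: the arcs of \<open>C\<close> that start in \<open>A\<close> number
  twice the vertices of \<open>C\<close> in \<open>A\<close>, and those that stay inside
  \<open>A\<close> are even in number.\<close>

lemma even_cut_cycle:
  fixes C :: "('v::linorder) pair_pre_digraph"
  assumes "pair_graph C" "regular_graph 2 C"
  shows "even (card {(u, v) \<in> parcs C. u \<in> A \<and> v \<notin> A})" (is "even (card ?cut)")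
proof -
  note C = pair_graphD[OF assms(1)]
  let ?in = "{(u, v) \<in> parcs C. u \<in> A \<and> v \<in> A}"
  have "even (card ?in)"
    by (rule even_card_sym_irrefl) (use C finite_subset[OF _ C(2), of ?in] in \<open>auto simp: sym_def\<close>)
  have "(\<Sum>v \<in> A \<inter> pverts C. card (parcs C `` {v})) = card (SIGMA v:A \<inter> pverts C. parcs C `` {v})"
    by (rule card_SigmaI[symmetric]) (use C finite_subset in auto)
  moreover have "(\<Sum>v \<in> A \<inter> pverts C. card (parcs C `` {v})) = (\<Sum>v \<in> A \<inter> pverts C. 2)"
    using assms(2) by (intro sum.cong) (auto simp: regular_graph_def out_degree_eq_card_Image)
  moreover have "(SIGMA v:A \<inter> pverts C. parcs C `` {v}) = ?in \<union> ?cut" using C(3) by auto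
  moreover have "card (?in \<union> ?cut) = card ?in + card ?cut"
    by (rule card_Un_disjoint) (auto intro: finite_subset[OF _ C(2)])
  ultimately have "card ?in + card ?cut = 2 * card (A \<inter> pverts C)" by simp
  then have "even (card ?in + card ?cut)" by (simp only: dvd_triv_left)
  with \<open>even (card ?in)\<close> show ?thesis by (simp only: even_add simp_thms)
qed

text \<open>The cut contains one arc per edge, directed out of \<open>A\<close>. By parity each of
  the two cycles through a cut edge crosses the cut in another edge; if the cut has at most two
  edges, this other edge is common to both cycles.\<close>

lemma card_cut_ge_3:
  fixes D :: "('v::linorder) pair_pre_digraph"
  assumes D: "pair_graph D" and con: "Digraph_Component.connected (with_proj D)"
    and cdc: "cycle_double_cover D Z" and poly: "describes_polyhedral_map Z"
    and A: "A \<subseteq> pverts D" "A \<noteq> {}" "A \<noteq> pverts D"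
  shows "card {(u, v) \<in> parcs D. u \<in> A \<and> v \<notin> A} \<ge> 3" (is "card ?cut \<ge> 3")
proof (rule ccontr)
  assume small: "\<not> ?thesis"
  note D = pair_graphD[OF D]
  have fin: "finite ?cut" by (rule finite_subset[OF _ D(2)]) auto
  obtain u v where uv: "(u, v) \<in> parcs D" "u \<in> A" "v \<notin> A"
    using con A unfolding connected_iff_cut[OF D(3,4)] by blast
  have "{u, v} \<in> uedges D" using uv by (force simp: uedges_def)
  with cdc have "card {C \<in> Z. {u, v} \<in> uedges C} = 2" by (simp add: cycle_double_cover_def)
  then obtain C C' where CC': "{C \<in> Z. {u, v} \<in> uedges C} = {C, C'}" "C \<noteq> C'"
    by (auto simp: card_2_iff)
  have *: "\<exists>e \<in> ?cut - {(u, v)}. e \<in> parcs c" if c: "c \<in> {C, C'}" for c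
  proof -
    have cZ: "c \<in> Z" and ce: "{u, v} \<in> uedges c" using c CC' by blast+
    with cdc have cyc: "pair_graph c" "regular_graph 2 c" "parcs c \<subseteq> parcs D"
      by (auto simp: cycle_double_cover_def cycle_subgraph_def subgraph_def)
    have "(u, v) \<in> parcs c"
      using ce pair_graphD(4)[OF cyc(1)] by (auto simp: uedges_def doubleton_eq_iff dest: symD)
    let ?c = "{(u, v) \<in> parcs c. u \<in> A \<and> v \<notin> A}"
    have uvc: "(u, v) \<in> ?c" using \<open>(u, v) \<in> parcs c\<close> uv by simp
    have "even (card ?c)" by (rule even_cut_cycle[OF cyc(1,2)])
    then have "?c \<noteq> {(u, v)}" by auto
    with uvc obtain e where "e \<in> ?c" "e \<noteq> (u, v)" by blast
    then show ?thesis using cyc(3) by auto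
  qed
  obtain e where e: "e \<in> ?cut" "e \<noteq> (u, v)" "e \<in> parcs C" using *[of C] by blast
  obtain e' where e': "e' \<in> ?cut" "e' \<noteq> (u, v)" "e' \<in> parcs C'" using *[of C'] by blast
  have "e = e'"
  proof (rule ccontr)
    assume "e \<noteq> e'"
    then have "card {(u, v), e, e'} = 3" using e e' by simp
    moreover have "card {(u, v), e, e'} \<le> card ?cut"
      by (rule card_mono[OF fin]) (use e e' uv in blast)
    ultimately show False using small by simp
  qed
  obtain x y where xy: "e = (x, y)" "x \<in> A" "y \<notin> A" using e by auto
  have "{x, y} \<noteq> {u, v}" using e(2) xy uv by (auto simp: doubleton_eq_iff)
  moreover have "{x, y} \<in> uedges C \<inter> uedges C'"
    using e e' \<open>e = e'\<close> xy by (force simp: uedges_def)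
  moreover have "{u, v} \<in> uedges C \<inter> uedges C'" using CC' by blast
  ultimately have "card {{x, y}, {u, v}} = 2" and sub: "{{x, y}, {u, v}} \<subseteq> uedges C \<inter> uedges C'"
    by auto
  moreover have "C \<in> Z" "C' \<in> Z" using CC' by blast+
  with poly CC'(2) have "card (uedges C \<inter> uedges C') \<le> 1" by (auto simp: describes_polyhedral_map_def)
  moreover have "finite (uedges C)"
    using cdc \<open>C \<in> Z\<close> by (auto simp: uedges_def cycle_double_cover_def cycle_subgraph_def dest: pair_graphD(2))
  then have "card {{x, y}, {u, v}} \<le> card (uedges C \<inter> uedges C')"
    by (intro card_mono sub) auto
  ultimately show False by linarith
qed

text \<open>Cubicity turns a separating set \<open>X\<close> of at most two vertices into an edge
  cut with at most \<open>card X\<close> edges, which \<open>card_cut_ge_3\<close> excludes.\<close>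

theorem cubic_polyhedral_3_connected:
  fixes D :: "('v::linorder) pair_pre_digraph"
  assumes D: "pair_graph D" and con: "Digraph_Component.connected (with_proj D)"
    and cubic: "regular_graph 3 D"
    and cdc: "cycle_double_cover D Z" and poly: "describes_polyhedral_map Z"
  shows "k_vertex_connected 3 D"
proof -
  note DD = pair_graphD[OF D]
  have deg: "card (parcs D `` {v}) = 3" if "v \<in> pverts D" for v
    using cubic that unfolding regular_graph_def out_degree_eq_card_Image by blast
  have "pverts D \<noteq> {}" using con connected_iff_cut[OF DD(3,4)] by blast
  then obtain v where v: "v \<in> pverts D" by blast
  have "card (insert v (parcs D `` {v})) = 4"
    using deg[OF v] DD(5) by (subst card_insert_disjoint) (auto intro: card_ge_0_finite)
  moreover have "card (insert v (parcs D `` {v})) \<le> card (pverts D)"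
    by (rule card_mono) (use DD v in auto)
  ultimately have "card (pverts D) > 3" by simp
  moreover have "Digraph_Component.connected (with_proj D \<restriction> (pverts D - X))"
    if X: "X \<subseteq> pverts D" "card X < 3" for X
  proof (rule ccontr)
    assume ncon: "\<not> ?thesis"
    let ?W = "pverts D - X"
    let ?D = "\<lparr>pverts = ?W, parcs = parcs D \<inter> ?W \<times> ?W\<rparr>"
    have finX: "finite X" using X DD(1) finite_subset by blast
    have "?W \<noteq> {}"
    proof
      assume "?W = {}"
      then have "card (pverts D) \<le> card X" using finX by (intro card_mono) auto
      with X \<open>card (pverts D) > 3\<close> show False by simp
    qed
    have "sym (parcs ?D)" using DD(4) by (auto simp: sym_def)
    with ncon \<open>?W \<noteq> {}\<close> obtain A where A: "A \<subseteq> ?W" "A \<noteq> {}" "A \<noteq> ?W"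
      and "\<nexists>u v. (u, v) \<in> parcs ?D \<and> u \<in> A \<and> v \<notin> A"
      unfolding restrict_with_proj using connected_iff_cut[of ?D] by auto
    then have closed: "v \<in> A" if "(u, v) \<in> parcs D" "u \<in> A" "v \<in> ?W" for u v
      using that by auto
    \<comment> \<open>Each vertex of \<open>X\<close> joins the side containing most of its neighbours, so that it
      contributes at most one edge to the cut.\<close>
    define X1 where "X1 = {x \<in> X. card (parcs D `` {x} \<inter> A) \<ge> 2}"
    let ?A = "A \<union> X1"
    let ?cut = "{(u, v) \<in> parcs D. u \<in> ?A \<and> v \<notin> ?A}"
    have finN: "finite (parcs D `` {x})" for x using DD(2) by auto
    have "card (parcs D `` {x} - A) \<le> 1" if "x \<in> X1" for x
    proof -
      have "card (parcs D `` {x}) = card (parcs D `` {x} \<inter> A) + card (parcs D `` {x} - A)"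
        using finN by (metis card_Int_Diff)
      moreover have "x \<in> pverts D" using that X by (auto simp: X1_def)
      ultimately show ?thesis using deg that by (auto simp: X1_def)
    qed
    then have "(\<Sum>x \<in> X1. card (parcs D `` {x} - A)) \<le> (\<Sum>x \<in> X1. 1)" by (intro sum_mono)
    then have c1: "card (SIGMA x:X1. parcs D `` {x} - A) \<le> card X1"
      using finX finN by (subst card_SigmaI) (auto simp: X1_def)
    have "(\<Sum>x \<in> X - X1. card (parcs D `` {x} \<inter> A)) \<le> (\<Sum>x \<in> X - X1. 1)"
      by (intro sum_mono) (auto simp: X1_def)
    then have c2: "card (SIGMA x:X - X1. parcs D `` {x} \<inter> A) \<le> card (X - X1)"
      using finX finN by (subst card_SigmaI) auto
    \<comment> \<open>No arc joins \<open>A\<close> to the rest of \<open>?W\<close>, so a cut arc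
      starts in \<open>X1\<close> or ends in \<open>X - X1\<close>. Arcs of the second kind are
      counted from their end in \<open>X\<close>, hence the swap.\<close>
    have "?cut \<subseteq> (SIGMA x:X1. parcs D `` {x} - A) \<union> prod.swap ` (SIGMA x:X - X1. parcs D `` {x} \<inter> A)"
    proof
      fix e assume e: "e \<in> ?cut"
      obtain u v where uv: "e = (u, v)" by fastforce
      have arc: "(u, v) \<in> parcs D" "(v, u) \<in> parcs D" "v \<notin> A" "v \<notin> X1" "v \<in> pverts D"
        using e uv DD(3,4) by (auto dest: symD)
      show "e \<in> (SIGMA x:X1. parcs D `` {x} - A) \<union> prod.swap ` (SIGMA x:X - X1. parcs D `` {x} \<inter> A)"
      proof (cases "u \<in> X1")
        case True
        then show ?thesis using arc uv by auto
      next
        case False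
        then have "u \<in> A" using e uv by auto
        then have "v \<in> X - X1" using closed arc by blast
        then have "(v, u) \<in> (SIGMA x:X - X1. parcs D `` {x} \<inter> A)" using arc \<open>u \<in> A\<close> by auto
        then show ?thesis unfolding uv by force
      qed
    qed
    then have "card ?cut \<le> card ((SIGMA x:X1. parcs D `` {x} - A) \<union> prod.swap ` (SIGMA x:X - X1. parcs D `` {x} \<inter> A))"
      using finX finN by (intro card_mono finite_UnI finite_imageI finite_SigmaI) (auto simp: X1_def)
    also have "\<dots> \<le> card (SIGMA x:X1. parcs D `` {x} - A) + card (prod.swap ` (SIGMA x:X - X1. parcs D `` {x} \<inter> A))"
      by (rule card_Un_le)
    also have "card (prod.swap ` (SIGMA x:X - X1. parcs D `` {x} \<inter> A)) = card (SIGMA x:X - X1. parcs D `` {x} \<inter> A)"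
      by (rule card_image) (auto simp: inj_on_def)
    also have "card (SIGMA x:X1. parcs D `` {x} - A) + card (SIGMA x:X - X1. parcs D `` {x} \<inter> A)
        \<le> card X1 + card (X - X1)" using c1 c2 by simp
    also have "\<dots> = card X" using finX by (subst card_Un_disjoint[symmetric]) (auto simp: X1_def intro: arg_cong[of _ _ card])
    finally have "card ?cut < 3" using X by simp
    moreover have "card ?cut \<ge> 3"
      by (rule card_cut_ge_3[OF D con cdc poly]) (use A X in \<open>auto simp: X1_def\<close>)
    ultimately show False by simp
  qed
  ultimately show ?thesis by (simp add: k_vertex_connected_def)
qed

section \<open>Voltage graphs over triangulated surfaces\<close>

text \<open>
  \<open>L\<close> is the set of triangles of a triangulated closed surface and \<open>fs l\<close> the set of the three
  corners of \<open>l\<close>.  Dually, \<open>L\<close> is the vertex set of a cubic graph, and \<open>fs l\<close> is the set of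
  faces around \<open>l\<close>.
\<close>

definition surface_adj :: "'l set \<Rightarrow> ('l \<Rightarrow> 'f set) \<Rightarrow> 'l \<Rightarrow> 'l \<Rightarrow> bool" where
  "surface_adj L fs l l' \<longleftrightarrow> l \<in> L \<and> l' \<in> L \<and> l \<noteq> l' \<and>
     (\<exists>f f'. f \<noteq> f' \<and> {f, f'} \<subseteq> fs l \<inter> fs l')"

text \<open>\<open>p\<close> is a potential for the voltages around \<open>f\<close>. Its existence
  makes the net voltage of every closed walk around \<open>f\<close> trivial, so that the boundary
  of \<open>f\<close> lifts isomorphically.\<close>

definition balanced_face ::
    "('a, 'b) monoid_scheme \<Rightarrow> 'l set \<Rightarrow> ('l \<Rightarrow> 'f set) \<Rightarrow> ('l \<Rightarrow> 'l \<Rightarrow> 'a) \<Rightarrow> 'f \<Rightarrow> bool" where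
  "balanced_face G L fs \<alpha> f \<longleftrightarrow> (\<exists>p \<in> L \<rightarrow> carrier G. \<forall>l l'.
     surface_adj L fs l l' \<and> f \<in> fs l \<inter> fs l' \<longrightarrow> p l' = p l \<otimes>\<^bsub>G\<^esub> \<alpha> l l')"

text \<open>\<open>opposite\<close> puts each side of a triangle on exactly one other triangle.
  \<open>balanced\<close> speaks of any two faces that meet at a vertex of the cubic graph.
  \<open>vtx\<close> packs a group element and a label into one vertex of a linearly ordered type;
  \<open>gr\<close> and \<open>lab\<close> unpack it.\<close>

locale voltage_surface = group G for G (structure) +
  fixes L :: "'l set" and fs :: "'l \<Rightarrow> 'f set" and \<alpha> :: "'l \<Rightarrow> 'l \<Rightarrow> 'a"
    and vtx :: "'a \<Rightarrow> 'l \<Rightarrow> 'v :: linorder" and gr :: "'v \<Rightarrow> 'a" and lab :: "'v \<Rightarrow> 'l"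
  assumes finite_carrier: "finite (carrier G)"
    and finite_L: "finite L"
    and card_fs: "l \<in> L \<Longrightarrow> card (fs l) = 3"
    and opposite: "\<lbrakk>l \<in> L; f \<in> fs l; f' \<in> fs l; f \<noteq> f'\<rbrakk> \<Longrightarrow>
      \<exists>!l'. l' \<in> L \<and> l' \<noteq> l \<and> f \<in> fs l' \<and> f' \<in> fs l'"
    and fs_inj: "\<lbrakk>l \<in> L; l' \<in> L; fs l = fs l'\<rbrakk> \<Longrightarrow> l = l'"
    and volt_closed: "surface_adj L fs l l' \<Longrightarrow> \<alpha> l l' \<in> carrier G"
    and volt_inv: "surface_adj L fs l l' \<Longrightarrow> \<alpha> l' l = inv (\<alpha> l l')"
    and balanced: "\<lbrakk>l \<in> L; f \<in> fs l; f' \<in> fs l; f \<noteq> f'\<rbrakk> \<Longrightarrow>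
      balanced_face G L fs \<alpha> f \<or> balanced_face G L fs \<alpha> f'"
    and gr_vtx: "\<lbrakk>g \<in> carrier G; l \<in> L\<rbrakk> \<Longrightarrow> gr (vtx g l) = g"
    and lab_vtx: "\<lbrakk>g \<in> carrier G; l \<in> L\<rbrakk> \<Longrightarrow> lab (vtx g l) = l"
begin

abbreviation adj where "adj \<equiv> surface_adj L fs"

lemma adj_in_L: "adj l l' \<Longrightarrow> l \<in> L" "adj l l' \<Longrightarrow> l' \<in> L"
  by (auto simp: surface_adj_def)

lemma adj_sym: "adj l l' \<Longrightarrow> adj l' l"
  by (auto simp: surface_adj_def)

lemma finite_fs: "l \<in> L \<Longrightarrow> finite (fs l)"
  using card_fs by (metis card.infinite zero_neq_numeral)

lemma fs_subset_imp_eq: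
  assumes "l \<in> L" "l' \<in> L" "fs l \<subseteq> fs l'"
  shows "l = l'"
proof (rule fs_inj)
  show "fs l = fs l'"
    using assms card_fs finite_fs by (intro card_subset_eq) auto
qed (use assms in auto)

text \<open>The neighbours lie across the three sides of \<open>l\<close>. None of them contains the
  third corner as well, since equal corner sets would identify it with \<open>l\<close>. So each
  face at \<open>l\<close> contains exactly two of the neighbours, which makes lifted faces
  2-regular.\<close>

lemma adj_nbrs:
  assumes l: "l \<in> L" and f: "f \<in> fs l"
  obtains f' f'' a b c where "fs l = {f, f', f''}" "distinct [f, f', f'']"
    "{l'. adj l l'} = {a, b, c}" "distinct [a, b, c]"
    "f \<in> fs a" "f' \<in> fs a" "f'' \<notin> fs a"
    "f \<in> fs b" "f' \<notin> fs b" "f'' \<in> fs b"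
    "f \<notin> fs c" "f' \<in> fs c" "f'' \<in> fs c"
proof -
  have "card (fs l - {f}) = 2" using card_fs[OF l] f by simp
  then obtain f' f'' where f'': "fs l - {f} = {f', f''}" "f' \<noteq> f''" by (auto simp: card_2_iff)
  then have fsl: "fs l = {f, f', f''}" and dist: "distinct [f, f', f'']" using f by auto
  have *: "\<exists>a. a \<in> L \<and> a \<noteq> l \<and> fs l \<inter> fs a = {x, y} \<and> (\<forall>l'. l' \<in> L \<and> l' \<noteq> l \<and> x \<in> fs l' \<and> y \<in> fs l' \<longrightarrow> l' = a)"
    if xyz: "fs l = {x, y, z}" "x \<noteq> y" for x y z
  proof -
    from opposite[OF l, of x y] xyz obtain a where a: "a \<in> L" "a \<noteq> l" "x \<in> fs a" "y \<in> fs a"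
      and uniq: "\<forall>l'. l' \<in> L \<and> l' \<noteq> l \<and> x \<in> fs l' \<and> y \<in> fs l' \<longrightarrow> l' = a" by blast
    have "z \<notin> fs a" using fs_subset_imp_eq[OF l a(1)] a xyz by auto
    then have "fs l \<inter> fs a = {x, y}" using a xyz by auto
    with a uniq show ?thesis by blast
  qed
  have perm: "fs l = {f, f'', f'}" "fs l = {f', f'', f}" and neq: "f \<noteq> f'" "f \<noteq> f''" "f' \<noteq> f''"
    using fsl dist by auto
  from *[OF fsl neq(1)] obtain a where a: "a \<in> L" "a \<noteq> l" "fs l \<inter> fs a = {f, f'}"
    "\<And>l'. l' \<in> L \<Longrightarrow> l' \<noteq> l \<Longrightarrow> f \<in> fs l' \<Longrightarrow> f' \<in> fs l' \<Longrightarrow> l' = a" by blast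
  from *[OF perm(1) neq(2)] obtain b where b: "b \<in> L" "b \<noteq> l" "fs l \<inter> fs b = {f, f''}"
    "\<And>l'. l' \<in> L \<Longrightarrow> l' \<noteq> l \<Longrightarrow> f \<in> fs l' \<Longrightarrow> f'' \<in> fs l' \<Longrightarrow> l' = b" by blast
  from *[OF perm(2) neq(3)] obtain c where c: "c \<in> L" "c \<noteq> l" "fs l \<inter> fs c = {f', f''}"
    "\<And>l'. l' \<in> L \<Longrightarrow> l' \<noteq> l \<Longrightarrow> f' \<in> fs l' \<Longrightarrow> f'' \<in> fs l' \<Longrightarrow> l' = c" by blast
  have "{l'. adj l l'} = {a, b, c}"
  proof
    show "{l'. adj l l'} \<subseteq> {a, b, c}"
    proof
      fix l' assume "l' \<in> {l'. adj l l'}"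
      then obtain x y where l': "l' \<in> L" "l' \<noteq> l" "x \<noteq> y" "x \<in> fs l" "y \<in> fs l" "x \<in> fs l'" "y \<in> fs l'"
        by (auto simp: surface_adj_def)
      then have "(f \<in> fs l' \<and> f' \<in> fs l') \<or> (f \<in> fs l' \<and> f'' \<in> fs l') \<or> (f' \<in> fs l' \<and> f'' \<in> fs l')"
        unfolding fsl by auto
      then show "l' \<in> {a, b, c}" using a(4) b(4) c(4) l' by auto
    qed
    have adj: "adj l k" if "k \<in> L" "k \<noteq> l" "fs l \<inter> fs k = {x, y}" "x \<noteq> y" for k x y
      using that l unfolding surface_adj_def by blast
    show "{a, b, c} \<subseteq> {l'. adj l l'}"
      using adj[OF a(1,2,3) neq(1)] adj[OF b(1,2,3) neq(2)] adj[OF c(1,2,3) neq(3)] by simp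
  qed
  moreover have mem: "f \<in> fs a" "f' \<in> fs a" "f'' \<notin> fs a"
    "f \<in> fs b" "f' \<notin> fs b" "f'' \<in> fs b"
    "f \<notin> fs c" "f' \<in> fs c" "f'' \<in> fs c"
  proof -
    have "f \<in> fs l" "f' \<in> fs l" "f'' \<in> fs l" by (simp_all add: fsl)
    moreover have "f \<in> fs l \<inter> fs a" "f' \<in> fs l \<inter> fs a" "f'' \<notin> fs l \<inter> fs a"
      "f \<in> fs l \<inter> fs b" "f' \<notin> fs l \<inter> fs b" "f'' \<in> fs l \<inter> fs b"
      "f \<notin> fs l \<inter> fs c" "f' \<in> fs l \<inter> fs c" "f'' \<in> fs l \<inter> fs c"
      unfolding a(3) b(3) c(3) using neq by simp_all
    ultimately show "f \<in> fs a" "f' \<in> fs a" "f'' \<notin> fs a"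
      "f \<in> fs b" "f' \<notin> fs b" "f'' \<in> fs b"
      "f \<notin> fs c" "f' \<in> fs c" "f'' \<in> fs c" by simp_all
  qed
  moreover have "distinct [a, b, c]" using mem by auto
  ultimately show thesis using that[OF fsl dist _ _ mem] by blast
qed

section \<open>The derived graph\<close>

definition V :: "'v set" where
  "V = {vtx g l | g l. g \<in> carrier G \<and> l \<in> L}"

text \<open>Voltages multiply the group coordinate from the right, so left multiplication commutes
  with them and acts by automorphisms.\<close>

definition E :: "'v rel" where
  "E = {(vtx g l, vtx (g \<otimes> \<alpha> l l') l') | g l l'. g \<in> carrier G \<and> adj l l'}"

definition D :: "'v pair_pre_digraph" where
  "D = \<lparr>pverts = V, parcs = E\<rparr>"

lemma D_simps [simp]: "pverts D = V" "parcs D = E"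
  by (simp_all add: D_def)

lemma vtx_in_V: "g \<in> carrier G \<Longrightarrow> l \<in> L \<Longrightarrow> vtx g l \<in> V"
  by (auto simp: V_def)

lemma in_VD:
  assumes "v \<in> V"
  shows "gr v \<in> carrier G" "lab v \<in> L" "vtx (gr v) (lab v) = v"
  using assms by (auto simp: V_def gr_vtx lab_vtx)

lemma V_eqI: "u \<in> V \<Longrightarrow> v \<in> V \<Longrightarrow> gr u = gr v \<Longrightarrow> lab u = lab v \<Longrightarrow> u = v"
  using in_VD(3) by metis

lemma E_iff:
  "(u, v) \<in> E \<longleftrightarrow> u \<in> V \<and> v \<in> V \<and> adj (lab u) (lab v) \<and> gr v = gr u \<otimes> \<alpha> (lab u) (lab v)"
proof
  assume "(u, v) \<in> E"
  then show "u \<in> V \<and> v \<in> V \<and> adj (lab u) (lab v) \<and> gr v = gr u \<otimes> \<alpha> (lab u) (lab v)"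
    by (auto simp: E_def gr_vtx lab_vtx adj_in_L volt_closed intro!: vtx_in_V)
next
  assume r: "u \<in> V \<and> v \<in> V \<and> adj (lab u) (lab v) \<and> gr v = gr u \<otimes> \<alpha> (lab u) (lab v)"
  then have "u = vtx (gr u) (lab u)" "v = vtx (gr u \<otimes> \<alpha> (lab u) (lab v)) (lab v)"
    using in_VD(3) by metis+
  with r show "(u, v) \<in> E" unfolding E_def using in_VD(1) by blast
qed

lemma E_vtx_iff:
  assumes "g \<in> carrier G" "h \<in> carrier G" "l \<in> L" "l' \<in> L"
  shows "(vtx g l, vtx h l') \<in> E \<longleftrightarrow> adj l l' \<and> h = g \<otimes> \<alpha> l l'"
  using assms by (simp add: E_iff vtx_in_V gr_vtx lab_vtx)

lemma sym_E: "sym E"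
proof (rule symI)
  fix u v assume uv: "(u, v) \<in> E"
  then have "adj (lab u) (lab v)" "u \<in> V" "v \<in> V" by (auto simp: E_iff)
  then have "gr v \<otimes> \<alpha> (lab v) (lab u) = gr u"
    using uv by (simp add: E_iff volt_inv volt_closed m_assoc in_VD)
  then show "(v, u) \<in> E" using uv by (auto simp: E_iff adj_sym)
qed

lemma E_lab_unique: "(u, v) \<in> E \<Longrightarrow> (u, w) \<in> E \<Longrightarrow> lab v = lab w \<Longrightarrow> v = w"
  by (auto simp: E_iff intro: V_eqI)

lemma E_step:
  assumes "u \<in> V" "adj (lab u) l'"
  obtains v where "(u, v) \<in> E" "lab v = l'"
proof
  have c: "gr u \<otimes> \<alpha> (lab u) l' \<in> carrier G" "l' \<in> L"
    using assms volt_closed in_VD adj_in_L by auto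
  show "lab (vtx (gr u \<otimes> \<alpha> (lab u) l') l') = l'" using c by (rule lab_vtx)
  show "(u, vtx (gr u \<otimes> \<alpha> (lab u) l') l') \<in> E"
    using c assms by (simp add: E_iff lab_vtx gr_vtx vtx_in_V)
qed

text \<open>\<open>lab\<close> is a covering projection: it maps the neighbours of \<open>u\<close>
  bijectively to the labels adjacent to \<open>lab u\<close>. Degrees in the cover are thus read off
  from the base.\<close>

lemma card_E_nbrs:
  assumes "u \<in> V"
  shows "card {v. (u, v) \<in> E \<and> P (lab v)} = card {l'. adj (lab u) l' \<and> P l'}"
proof -
  have "bij_betw lab {v. (u, v) \<in> E \<and> P (lab v)} {l'. adj (lab u) l' \<and> P l'}"
    unfolding bij_betw_def
  proof
    show "inj_on lab {v. (u, v) \<in> E \<and> P (lab v)}"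
      by (rule inj_onI) (auto intro: E_lab_unique)
    show "lab ` {v. (u, v) \<in> E \<and> P (lab v)} = {l'. adj (lab u) l' \<and> P l'}"
      using E_step[OF assms] by (fastforce simp: E_iff)
  qed
  then show ?thesis by (rule bij_betw_same_card)
qed

lemma pair_graph_D: "pair_graph D"
proof (rule pair_graphI)
  have "V = (\<lambda>(g, l). vtx g l) ` (carrier G \<times> L)" by (auto simp: V_def)
  then show "finite (pverts D)" using finite_carrier finite_L by simp
  show "parcs D \<subseteq> pverts D \<times> pverts D" by (auto simp: E_iff)
  show "(v, v) \<notin> parcs D" for v by (auto simp: E_iff surface_adj_def)
qed (simp add: sym_E)

lemma cubic_D: "regular_graph 3 D"
  unfolding regular_graph_def out_degree_eq_card_Image
proof
  fix v assume v: "v \<in> pverts D"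
  then have l: "lab v \<in> L" using in_VD by simp
  then obtain f where "f \<in> fs (lab v)" using card_fs by fastforce
  then obtain a b c where "{l'. adj (lab v) l'} = {a, b, c}" "distinct [a, b, c]"
    by (rule adj_nbrs[OF l])
  then show "card (parcs D `` {v}) = 3"
    using card_E_nbrs[of v "\<lambda>_. True"] v by (simp add: Image_singleton)
qed

section \<open>Lifted faces as a polyhedral cycle double cover\<close>

definition face_arcs :: "'f \<Rightarrow> 'v rel" where
  "face_arcs f = {(u, v) \<in> E. f \<in> fs (lab u) \<and> f \<in> fs (lab v)}"

text \<open>The component through \<open>v\<close> of the preimage of the face \<open>f\<close>. It
  maps injectively to the base if \<open>f\<close> is balanced and may wind around the face several
  times otherwise.\<close>

definition face_cycle :: "'f \<Rightarrow> 'v \<Rightarrow> 'v pair_pre_digraph" where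
  "face_cycle f v = \<lparr>pverts = (face_arcs f)\<^sup>* `` {v},
     parcs = {(x, y) \<in> face_arcs f. (v, x) \<in> (face_arcs f)\<^sup>*}\<rparr>"

definition Z :: "'v pair_pre_digraph set" where
  "Z = {face_cycle f v | f v. v \<in> V \<and> f \<in> fs (lab v)}"

lemma sym_face_arcs: "sym (face_arcs f)"
  using sym_E by (auto simp: face_arcs_def sym_def)

lemma face_cycle_eq:
  assumes "(v, w) \<in> (face_arcs f)\<^sup>*"
  shows "face_cycle f w = face_cycle f v"
proof -
  have "(w, v) \<in> (face_arcs f)\<^sup>*"
    using assms sym_rtrancl[OF sym_face_arcs] by (auto dest: symD)
  with assms have "(w, x) \<in> (face_arcs f)\<^sup>* \<longleftrightarrow> (v, x) \<in> (face_arcs f)\<^sup>*" for x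
    by (meson rtrancl_trans)
  then show ?thesis by (auto simp: face_cycle_def)
qed

lemma face_cycle_verts:
  assumes "(v, w) \<in> (face_arcs f)\<^sup>*" "v \<in> V" "f \<in> fs (lab v)"
  shows "w \<in> V \<and> f \<in> fs (lab w)"
  using assms by induct (auto simp: face_arcs_def E_iff)

lemma face_cycle_pair_graph:
  assumes "v \<in> V" "f \<in> fs (lab v)"
  shows "pair_graph (face_cycle f v)"
proof (rule pair_graphI)
  show "finite (pverts (face_cycle f v))"
    by (rule finite_subset[OF _ pair_graphD(1)[OF pair_graph_D]])
      (use face_cycle_verts assms in \<open>auto simp: face_cycle_def\<close>)
  show "parcs (face_cycle f v) \<subseteq> pverts (face_cycle f v) \<times> pverts (face_cycle f v)"
    by (auto simp: face_cycle_def)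
  show "sym (parcs (face_cycle f v))"
    using sym_face_arcs[of f] by (auto simp: face_cycle_def sym_def intro: rtrancl_into_rtrancl)
  show "(x, x) \<notin> parcs (face_cycle f v)" for x
    using pair_graphD(5)[OF pair_graph_D] by (auto simp: face_cycle_def face_arcs_def)
qed

lemma face_cycle_connected:
  assumes "v \<in> V" "f \<in> fs (lab v)"
  shows "Digraph_Component.connected (with_proj (face_cycle f v))"
proof -
  note C = pair_graphD[OF face_cycle_pair_graph[OF assms]]
  have "\<exists>x y. (x, y) \<in> parcs (face_cycle f v) \<and> x \<in> A \<and> y \<notin> A"
    if A: "A \<subseteq> pverts (face_cycle f v)" "A \<noteq> {}" "A \<noteq> pverts (face_cycle f v)" for A
  proof (rule ccontr)
    assume n: "\<not> ?thesis"
    obtain a b where ab: "a \<in> A" "b \<in> pverts (face_cycle f v)" "b \<notin> A" using A by blast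
    then have va: "(v, a) \<in> (face_arcs f)\<^sup>*" and vb: "(v, b) \<in> (face_arcs f)\<^sup>*"
      using A by (auto simp: face_cycle_def)
    have "(a, b) \<in> (face_arcs f)\<^sup>*"
      using va vb sym_rtrancl[OF sym_face_arcs] by (meson rtrancl_trans symD)
    then have "b \<in> A"
    proof induct
      case (step y z)
      then have "(y, z) \<in> parcs (face_cycle f v)" using va
        by (auto simp: face_cycle_def intro: rtrancl_trans)
      with n step show ?case by blast
    qed (rule ab)
    with ab show False by blast
  qed
  then show ?thesis unfolding connected_iff_cut[OF C(3,4)] by (auto simp: face_cycle_def)
qed

lemma face_cycle_cycle_subgraph:
  assumes "v \<in> V" "f \<in> fs (lab v)"
  shows "cycle_subgraph (face_cycle f v) D"
  unfolding cycle_subgraph_def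
proof (intro conjI)
  show C: "pair_graph (face_cycle f v)" using assms by (rule face_cycle_pair_graph)
  show "Digraph_Component.connected (with_proj (face_cycle f v))"
    using assms by (rule face_cycle_connected)
  have wf: "wf_digraph (with_proj H)" if "parcs H \<subseteq> pverts H \<times> pverts H" for H :: "'v pair_pre_digraph"
    using that by (auto simp: wf_digraph_def)
  show "subgraph (with_proj (face_cycle f v)) (with_proj D)"
    unfolding subgraph_def
  proof (intro conjI)
    show "verts (with_proj (face_cycle f v)) \<subseteq> verts (with_proj D)"
      using face_cycle_verts[OF _ assms] by (auto simp: face_cycle_def)
    show "arcs (with_proj (face_cycle f v)) \<subseteq> arcs (with_proj D)"
      by (auto simp: face_cycle_def face_arcs_def)
    show "wf_digraph (with_proj D)" "wf_digraph (with_proj (face_cycle f v))"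
      using wf pair_graphD(3)[OF C] pair_graphD(3)[OF pair_graph_D] by blast+
  qed (rule compatibleI_with_proj)
  show "regular_graph 2 (face_cycle f v)"
    unfolding regular_graph_def out_degree_eq_card_Image
  proof
    fix w assume "w \<in> pverts (face_cycle f v)"
    then have vw: "(v, w) \<in> (face_arcs f)\<^sup>*" by (simp add: face_cycle_def)
    then have w: "w \<in> V" "f \<in> fs (lab w)" using face_cycle_verts assms by blast+
    obtain a b c where n: "{l'. adj (lab w) l'} = {a, b, c}" "distinct [a, b, c]"
      "f \<in> fs a" "f \<in> fs b" "f \<notin> fs c"
      by (rule adj_nbrs[OF in_VD(2)[OF w(1)] w(2)])
    have "{l'. adj (lab w) l' \<and> f \<in> fs l'} = {l' \<in> {l'. adj (lab w) l'}. f \<in> fs l'}" by simp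
    also have "\<dots> = {a, b}" unfolding n(1) using n(3-5) by auto
    finally have "{l'. adj (lab w) l' \<and> f \<in> fs l'} = {a, b}" "a \<noteq> b" using n(2) by auto
    then have "card {x. (w, x) \<in> E \<and> f \<in> fs (lab x)} = 2" using card_E_nbrs[OF w(1), of "\<lambda>l. f \<in> fs l"] by simp
    moreover have "parcs (face_cycle f v) `` {w} = {x. (w, x) \<in> E \<and> f \<in> fs (lab x)}"
      using vw w by (auto simp: face_cycle_def face_arcs_def)
    ultimately show "card (parcs (face_cycle f v) `` {w}) = 2" by simp
  qed
qed

text \<open>The neighbour of \<open>v\<close> across the side that avoids \<open>f\<close> lies on
  \<open>f'\<close> but not on \<open>f\<close>.\<close>

lemma face_cycle_neq:
  assumes v: "v \<in> V" and f: "f \<in> fs (lab v)" and f': "f' \<in> fs (lab v)" and "f \<noteq> f'"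
  shows "face_cycle f v \<noteq> face_cycle f' v"
proof -
  obtain g g' a b c where n: "fs (lab v) = {f, g, g'}" "{l'. adj (lab v) l'} = {a, b, c}"
    "f \<notin> fs c" "g \<in> fs c" "g' \<in> fs c"
    by (rule adj_nbrs[OF in_VD(2)[OF v] f])
  have "c \<in> {l'. adj (lab v) l'}" unfolding n(2) by simp
  then have c: "adj (lab v) c" "f \<notin> fs c" "f' \<in> fs c" using n f' \<open>f \<noteq> f'\<close> by auto
  obtain w where "(v, w) \<in> E" "lab w = c" using E_step[OF v c(1)] .
  then have "(v, w) \<in> parcs (face_cycle f' v)" "(v, w) \<notin> parcs (face_cycle f v)"
    using c f' by (auto simp: face_cycle_def face_arcs_def)
  then show ?thesis by metis
qed

text \<open>Lets an end of any edge of a lifted face replace the base point \<open>v\<close>, so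
  that two lifted faces through an edge can be compared at the same vertex.\<close>

lemma face_cycle_uedge:
  assumes "v \<in> V" "f \<in> fs (lab v)" and e: "{x, y} \<in> uedges (face_cycle f v)"
  shows "(x, y) \<in> E" "f \<in> fs (lab x)" "f \<in> fs (lab y)" "face_cycle f v = face_cycle f x"
proof -
  have "sym (parcs (face_cycle f v))" by (rule pair_graphD(4)[OF face_cycle_pair_graph[OF assms(1,2)]])
  with e have "(x, y) \<in> parcs (face_cycle f v)"
    by (auto simp: uedges_def doubleton_eq_iff dest: symD)
  then have "(x, y) \<in> face_arcs f" and vx: "(v, x) \<in> (face_arcs f)\<^sup>*" by (auto simp: face_cycle_def)
  then show "(x, y) \<in> E" "f \<in> fs (lab x)" "f \<in> fs (lab y)" by (auto simp: face_arcs_def)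
  show "face_cycle f v = face_cycle f x" using face_cycle_eq[OF vx] by simp
qed

text \<open>The two cycles through an edge at \<open>u\<close> are the lifts at \<open>u\<close> of
  the two faces shared by the labels of its ends.\<close>

lemma cycle_double_cover_Z: "cycle_double_cover D Z"
  unfolding cycle_double_cover_def
proof
  show "\<forall>C \<in> Z. cycle_subgraph C D" by (auto simp: Z_def face_cycle_cycle_subgraph)
  show "\<forall>e \<in> uedges D. card {C \<in> Z. e \<in> uedges C} = 2"
  proof
    fix e assume "e \<in> uedges D"
    then obtain u v where e: "e = {u, v}" and uv: "(u, v) \<in> E" by (auto simp: uedges_def)
    then have u: "u \<in> V" and adj: "adj (lab u) (lab v)" by (auto simp: E_iff)
    obtain h where h: "h \<in> fs (lab u)" using adj by (auto simp: surface_adj_def)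
    obtain h' h'' a b c where n: "fs (lab u) = {h, h', h''}" "distinct [h, h', h'']"
      "{l'. adj (lab u) l'} = {a, b, c}"
      and m: "h \<in> fs a" "h' \<in> fs a" "h'' \<notin> fs a" "h \<in> fs b" "h' \<notin> fs b" "h'' \<in> fs b"
      "h \<notin> fs c" "h' \<in> fs c" "h'' \<in> fs c"
      by (rule adj_nbrs[OF adj_in_L(1)[OF adj] h])
    have "lab v \<in> {a, b, c}" using adj n(3) by blast
    then have "fs (lab u) \<inter> fs (lab v) \<in> {{h, h'}, {h, h''}, {h', h''}}"
      unfolding n(1) using m by auto
    then obtain f f' where f: "fs (lab u) \<inter> fs (lab v) = {f, f'}" "f \<noteq> f'"
      using n(2) by (metis distinct_length_2_or_more empty_iff insert_iff)
    have mem: "f \<in> fs (lab u) \<inter> fs (lab v)" "f' \<in> fs (lab u) \<inter> fs (lab v)"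
      unfolding f(1) by simp_all
    have "{C \<in> Z. e \<in> uedges C} = {face_cycle f u, face_cycle f' u}"
    proof
      show "{C \<in> Z. e \<in> uedges C} \<subseteq> {face_cycle f u, face_cycle f' u}"
      proof
        fix C assume "C \<in> {C \<in> Z. e \<in> uedges C}"
        then obtain g w where "C = face_cycle g w" "w \<in> V" "g \<in> fs (lab w)" "{u, v} \<in> uedges C"
          unfolding Z_def e by blast
        then have "g \<in> fs (lab u) \<inter> fs (lab v)" "C = face_cycle g u"
          using face_cycle_uedge by blast+
        then show "C \<in> {face_cycle f u, face_cycle f' u}" unfolding f(1) by blast
      qed
      have "face_cycle g u \<in> Z \<and> e \<in> uedges (face_cycle g u)" if "g \<in> fs (lab u) \<inter> fs (lab v)" for g
        using that u uv unfolding e by (force simp: Z_def uedges_def face_cycle_def face_arcs_def)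
      then show "{face_cycle f u, face_cycle f' u} \<subseteq> {C \<in> Z. e \<in> uedges C}" using mem by simp
    qed
    moreover have "face_cycle f u \<noteq> face_cycle f' u"
      by (rule face_cycle_neq[OF u]) (use mem f(2) in auto)
    ultimately show "card {C \<in> Z. e \<in> uedges C} = 2" by simp
  qed
qed

text \<open>For a potential \<open>p\<close>, the element
  \<open>gr x \<otimes> inv (p (lab x))\<close> is constant along the lifted face, so the label
  determines the group coordinate.\<close>

lemma balanced_face_cycle_inj:
  assumes bal: "balanced_face G L fs \<alpha> f" and v: "v \<in> V"
    and "(v, w) \<in> (face_arcs f)\<^sup>*" "(v, w') \<in> (face_arcs f)\<^sup>*" "f \<in> fs (lab v)" "lab w = lab w'"
  shows "w = w'"
proof -
  from bal obtain p where p: "p \<in> L \<rightarrow> carrier G"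
    "\<And>l l'. adj l l' \<Longrightarrow> f \<in> fs l \<Longrightarrow> f \<in> fs l' \<Longrightarrow> p l' = p l \<otimes> \<alpha> l l'"
    unfolding balanced_face_def by blast
  have inv: "gr x \<otimes> inv (p (lab x)) = gr v \<otimes> inv (p (lab v))" if "(v, x) \<in> (face_arcs f)\<^sup>*" for x
    using that
  proof induct
    case (step x y)
    then have xy: "(x, y) \<in> E" "f \<in> fs (lab x)" "f \<in> fs (lab y)" by (auto simp: face_arcs_def)
    then have a: "adj (lab x) (lab y)" "x \<in> V" "y \<in> V" "gr y = gr x \<otimes> \<alpha> (lab x) (lab y)"
      by (auto simp: E_iff)
    have c: "p (lab x) \<in> carrier G" "\<alpha> (lab x) (lab y) \<in> carrier G" "gr x \<in> carrier G"
      using p(1) a volt_closed in_VD by auto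
    have "gr y \<otimes> inv (p (lab y)) =
        gr x \<otimes> (\<alpha> (lab x) (lab y) \<otimes> inv (\<alpha> (lab x) (lab y))) \<otimes> inv (p (lab x))"
      using c by (simp only: a(4) p(2)[OF a(1) xy(2,3)] inv_mult_group m_assoc m_closed inv_closed)
    then show ?case using c step by (simp add: r_inv)
  qed simp
  have "w \<in> V" "w' \<in> V" using face_cycle_verts assms by blast+
  moreover have "gr w \<otimes> inv (p (lab w)) = gr w' \<otimes> inv (p (lab w))"
    using inv assms by metis
  then have "gr w = gr w'" using p(1) \<open>w \<in> V\<close> \<open>w' \<in> V\<close> in_VD by (auto simp: Pi_iff)
  ultimately show ?thesis using assms by (intro V_eqI)
qed

text \<open>Distinct lifts with a common edge lie over distinct faces \<open>f\<close> and
  \<open>f'\<close>. By \<open>opposite\<close> only two labels lie on both faces, so all common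
  edges lie over one base edge. One of the two faces is balanced, and its lift has only one edge
  there.\<close>

lemma describes_polyhedral_map_Z: "describes_polyhedral_map Z"
  unfolding describes_polyhedral_map_def
proof (intro ballI impI)
  fix C C' assume C: "C \<in> Z" "C' \<in> Z" "C \<noteq> C'"
  obtain f v where f: "C = face_cycle f v" "v \<in> V" "f \<in> fs (lab v)" using C by (auto simp: Z_def)
  obtain f' v' where f': "C' = face_cycle f' v'" "v' \<in> V" "f' \<in> fs (lab v')" using C by (auto simp: Z_def)
  \<comment> \<open>The ends of the two edges are matched by label here; the crossed matching is
    obtained below by exchanging \<open>x\<close> and \<open>y\<close>.\<close>
  have eq: "u = x \<and> w = y"
    if uw: "{u, w} \<in> uedges C" "{u, w} \<in> uedges C'" and xy: "{x, y} \<in> uedges C" "{x, y} \<in> uedges C'"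
      and lab: "lab u = lab x" "lab w = lab y" for u w x y
  proof -
    note 1 = face_cycle_uedge[OF f(2,3) uw(1)[unfolded f(1)]]
      face_cycle_uedge[OF f'(2,3) uw(2)[unfolded f'(1)]]
    have "f \<noteq> f'" using 1 C(3) f(1) f'(1) by metis
    moreover have "lab u \<in> L" using 1 in_VD by (auto simp: E_iff)
    ultimately have "balanced_face G L fs \<alpha> f \<or> balanced_face G L fs \<alpha> f'"
      using balanced 1 by blast
    moreover have "u = x \<and> w = y"
      if b: "balanced_face G L fs \<alpha> g" "z \<in> V" "g \<in> fs (lab z)"
        "{u, w} \<in> uedges (face_cycle g z)" "{x, y} \<in> uedges (face_cycle g z)" for g z
    proof -
      have r: "(z, s) \<in> (face_arcs g)\<^sup>*" if "{s, t} \<in> uedges (face_cycle g z)" for s t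
        using pair_graphD(3)[OF face_cycle_pair_graph[OF b(2,3)]] that
        by (auto simp: uedges_def face_cycle_def doubleton_eq_iff)
      have r': "(z, t) \<in> (face_arcs g)\<^sup>*" if "{s, t} \<in> uedges (face_cycle g z)" for s t
        using r[of t s] that by (simp add: insert_commute)
      show ?thesis
        using balanced_face_cycle_inj[OF b(1,2) _ _ b(3)] r r' b(4,5) lab by blast
    qed
    ultimately show ?thesis using f f' uw xy by blast
  qed
  have "e = e'" if e: "e \<in> uedges C \<inter> uedges C'" and e': "e' \<in> uedges C \<inter> uedges C'" for e e'
  proof -
    obtain u w where u: "e = {u, w}" using e by (auto simp: uedges_def)
    obtain x y where x: "e' = {x, y}" using e' by (auto simp: uedges_def)
    have uw: "{u, w} \<in> uedges C" "{u, w} \<in> uedges C'" and xy: "{x, y} \<in> uedges C" "{x, y} \<in> uedges C'"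
      using e e' u x by auto
    note 1 = face_cycle_uedge[OF f(2,3) uw(1)[unfolded f(1)]]
      face_cycle_uedge[OF f'(2,3) uw(2)[unfolded f'(1)]]
    note 2 = face_cycle_uedge[OF f(2,3) xy(1)[unfolded f(1)]]
      face_cycle_uedge[OF f'(2,3) xy(2)[unfolded f'(1)]]
    have "f \<noteq> f'" using 1 C(3) f(1) f'(1) by metis
    have L: "lab u \<in> L" "lab w \<in> L" "lab x \<in> L" "lab y \<in> L" "lab u \<noteq> lab w" "lab x \<noteq> lab y"
      using 1 2 by (auto simp: E_iff surface_adj_def)
    then obtain l' where "\<And>l. l \<in> L \<Longrightarrow> l \<noteq> lab u \<Longrightarrow> f \<in> fs l \<Longrightarrow> f' \<in> fs l \<Longrightarrow> l = l'"
      using opposite[OF L(1) 1(2) 1(6) \<open>f \<noteq> f'\<close>] by blast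
    then have "lab u = lab x \<and> lab w = lab y \<or> lab u = lab y \<and> lab w = lab x"
      using 1 2 L by metis
    then show ?thesis
    proof
      assume "lab u = lab x \<and> lab w = lab y"
      then show ?thesis using eq[OF uw xy] u x by blast
    next
      assume "lab u = lab y \<and> lab w = lab x"
      then show ?thesis using eq[OF uw, of y x] xy u x by (simp add: insert_commute)
    qed
  qed
  then show "card (uedges C \<inter> uedges C') \<le> 1"
    by (metis (no_types, lifting) card_le_Suc0_iff_eq One_nat_def card.infinite zero_le)
qed

end

section \<open>Automorphisms of the derived graph\<close>

context voltage_surface
begin

text \<open>The restriction to \<open>V\<close> places \<open>act h\<close> in
  \<open>extensional V\<close>, as membership in \<open>Bij V\<close> requires.\<close>

definition act :: "'a \<Rightarrow> 'v \<Rightarrow> 'v" where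
  "act h = (\<lambda>v\<in>V. vtx (h \<otimes> gr v) (lab v))"

lemma act_simps [simp]:
  assumes "h \<in> carrier G" "v \<in> V"
  shows "act h v \<in> V" "gr (act h v) = h \<otimes> gr v" "lab (act h v) = lab v"
  using assms by (simp_all add: act_def vtx_in_V in_VD gr_vtx lab_vtx)

lemma act_mult:
  assumes "h \<in> carrier G" "k \<in> carrier G" "v \<in> V"
  shows "act (h \<otimes> k) v = act h (act k v)"
  by (rule V_eqI) (use assms in \<open>simp_all add: m_assoc in_VD\<close>)

lemma act_one: "v \<in> V \<Longrightarrow> act \<one> v = v"
  by (rule V_eqI) (simp_all add: in_VD)

lemma act_inv:
  assumes "h \<in> carrier G" "v \<in> V"
  shows "act (inv h) (act h v) = v" "act h (act (inv h) v) = v"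
  using assms by (simp_all add: act_one flip: act_mult)

lemma act_E_iff:
  assumes "h \<in> carrier G" "u \<in> V" "v \<in> V"
  shows "(act h u, act h v) \<in> E \<longleftrightarrow> (u, v) \<in> E"
  using assms by (auto simp: E_iff m_assoc volt_closed in_VD)

lemma act_auts:
  assumes h: "h \<in> carrier G"
  shows "act h \<in> graph_auts D"
proof -
  have "bij_betw (act h) V V"
    by (rule bij_betw_byWitness[where f' = "act (inv h)"]) (use h in \<open>auto simp: act_inv\<close>)
  moreover have "act h \<in> extensional V" by (simp add: act_def)
  ultimately show ?thesis using h by (simp add: graph_auts_def Bij_def act_E_iff)
qed

lemma act_iso:
  assumes "L \<noteq> {}" and "graph_auts D = act ` carrier G"
  shows "act \<in> iso G (Aut_graph D)"
proof (rule isoI)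
  have Bij: "act h \<in> Bij V" if "h \<in> carrier G" for h
    using act_auts[OF that] by (simp add: graph_auts_def)
  show "act \<in> hom G (Aut_graph D)"
  proof (rule homI)
    fix h k assume hk: "h \<in> carrier G" "k \<in> carrier G"
    show "act h \<in> carrier (Aut_graph D)" using hk by (simp add: Aut_graph_def act_auts)
    have "act (h \<otimes> k) = compose V (act h) (act k)"
    proof
      fix v
      show "act (h \<otimes> k) v = compose V (act h) (act k) v"
      proof (cases "v \<in> V")
        case True
        then show ?thesis using hk by (simp add: compose_def act_mult)
      qed (simp add: compose_def act_def)
    qed
    then show "act (h \<otimes> k) = act h \<otimes>\<^bsub>Aut_graph D\<^esub> act k"
      using hk Bij by (simp add: Aut_graph_def BijGroup_def)
  qed
  obtain l where l: "l \<in> L" using assms by blast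
  have "inj_on act (carrier G)"
  proof (rule inj_onI)
    fix h k assume "h \<in> carrier G" "k \<in> carrier G" "act h = act k"
    then have "h \<otimes> gr (vtx \<one> l) = k \<otimes> gr (vtx \<one> l)"
      using act_simps(2)[OF _ vtx_in_V] l by (metis one_closed)
    then show "h = k" using \<open>h \<in> carrier G\<close> \<open>k \<in> carrier G\<close> l by (simp add: gr_vtx)
  qed
  then show "bij_betw act (carrier G) (carrier (Aut_graph D))"
    using assms by (simp add: bij_betw_def Aut_graph_def)
qed

lemma face_arcs_act:
  assumes h: "h \<in> carrier G" and "(v, w) \<in> (face_arcs f)\<^sup>*" "v \<in> V"
  shows "(act h v, act h w) \<in> (face_arcs f)\<^sup>*"
  using assms(2)
proof induct
  case (step x y)
  then have "(act h x, act h y) \<in> face_arcs f"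
    using h by (auto simp: face_arcs_def act_E_iff E_iff m_assoc volt_closed in_VD)
  with step show ?case by simp
qed simp

text \<open>\<open>act h\<close> preserves arcs and labels, hence the preimage of each face, and
  carries the component of \<open>v\<close> to that of \<open>act h v\<close>. Surjectivity comes
  from \<open>act (inv h)\<close>.\<close>

lemma graph_image_act:
  assumes h: "h \<in> carrier G" and v: "v \<in> V" "f \<in> fs (lab v)"
  shows "graph_image (act h) (face_cycle f v) = face_cycle f (act h v)"
proof -
  have 1: "(act h v, act h w) \<in> (face_arcs f)\<^sup>* \<and> w \<in> V" if "(v, w) \<in> (face_arcs f)\<^sup>*" for w
    using face_arcs_act[OF h that v(1)] face_cycle_verts[OF that v] by blast
  have 2: "\<exists>x. w = act h x \<and> (v, x) \<in> (face_arcs f)\<^sup>* \<and> x \<in> V" if "(act h v, w) \<in> (face_arcs f)\<^sup>*" for w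
  proof -
    have "w \<in> V" using face_cycle_verts[OF that] h v by simp
    moreover have "(v, act (inv h) w) \<in> (face_arcs f)\<^sup>*"
      using face_arcs_act[OF inv_closed[OF h] that] h v by (simp add: act_inv)
    ultimately show ?thesis using h by (metis act_inv(2) act_simps(1) inv_closed)
  qed
  have F: "(act h x, act h y) \<in> face_arcs f \<longleftrightarrow> (x, y) \<in> face_arcs f" if "x \<in> V" "y \<in> V" for x y
    using h that by (simp add: face_arcs_def act_E_iff)
  have "act h ` pverts (face_cycle f v) = pverts (face_cycle f (act h v))"
  proof
    show "act h ` pverts (face_cycle f v) \<subseteq> pverts (face_cycle f (act h v))"
      using 1 by (auto simp: face_cycle_def)
    show "pverts (face_cycle f (act h v)) \<subseteq> act h ` pverts (face_cycle f v)"
      using 2 by (fastforce simp: face_cycle_def)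
  qed
  moreover have "map_prod (act h) (act h) ` parcs (face_cycle f v) = parcs (face_cycle f (act h v))"
  proof
    show "map_prod (act h) (act h) ` parcs (face_cycle f v) \<subseteq> parcs (face_cycle f (act h v))"
    proof
      fix e assume "e \<in> map_prod (act h) (act h) ` parcs (face_cycle f v)"
      then obtain x y where e: "e = (act h x, act h y)" and xy: "(x, y) \<in> face_arcs f" "(v, x) \<in> (face_arcs f)\<^sup>*"
        by (auto simp: face_cycle_def)
      then have "(v, y) \<in> (face_arcs f)\<^sup>*" by simp
      with xy 1 F show "e \<in> parcs (face_cycle f (act h v))" by (auto simp: e face_cycle_def)
    qed
    show "parcs (face_cycle f (act h v)) \<subseteq> map_prod (act h) (act h) ` parcs (face_cycle f v)"
    proof
      fix e assume "e \<in> parcs (face_cycle f (act h v))"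
      then obtain x y where e: "e = (x, y)" and xy: "(x, y) \<in> face_arcs f" "(act h v, x) \<in> (face_arcs f)\<^sup>*"
        by (auto simp: face_cycle_def)
      then have "(act h v, y) \<in> (face_arcs f)\<^sup>*" by simp
      with xy(2) obtain x' y' where x': "x = act h x'" "(v, x') \<in> (face_arcs f)\<^sup>*" "x' \<in> V"
        and y': "y = act h y'" "y' \<in> V" using 2 by blast
      then have "(x', y') \<in> parcs (face_cycle f v)" using xy F by (simp add: face_cycle_def)
      then show "e \<in> map_prod (act h) (act h) ` parcs (face_cycle f v)"
        unfolding e x'(1) y'(1) by (rule map_prod_imageI)
    qed
  qed
  ultimately show ?thesis by (simp add: graph_image_def face_cycle_def)
qed

section \<open>Automorphisms and the labels they respect\<close>

lemma graph_autsD: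
  assumes "\<phi> \<in> graph_auts D"
  shows "bij_betw \<phi> V V" "\<phi> \<in> extensional V" "v \<in> V \<Longrightarrow> \<phi> v \<in> V"
    and "u \<in> V \<Longrightarrow> v \<in> V \<Longrightarrow> (\<phi> u, \<phi> v) \<in> E \<longleftrightarrow> (u, v) \<in> E"
  using assms by (auto simp: graph_auts_def Bij_def dest: bij_betwE)

lemma graph_auts_E_surj:
  assumes "\<phi> \<in> graph_auts D" "v \<in> V" "(\<phi> v, w') \<in> E"
  obtains w where "w' = \<phi> w" "w \<in> V" "(v, w) \<in> E"
proof -
  have "w' \<in> V" using assms by (simp add: E_iff)
  then obtain w where w: "w' = \<phi> w" "w \<in> V"
    using graph_autsD(1)[OF assms(1)] by (auto simp: bij_betw_def)
  then show thesis using that assms graph_autsD(4)[OF assms(1)] by blast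
qed

text \<open>Uniqueness of lifts: the neighbours of a vertex are told apart by their labels, so
  agreement of \<open>\<phi>\<close> with \<open>act h\<close> spreads along arcs. The element
  \<open>h\<close> is chosen to give agreement at \<open>v0\<close>.\<close>

lemma lab_preserving_aut:
  assumes \<phi>: "\<phi> \<in> graph_auts D" and lab: "\<And>v. v \<in> V \<Longrightarrow> lab (\<phi> v) = lab v"
    and con: "Digraph_Component.connected (with_proj D)"
  shows "\<phi> \<in> act ` carrier G"
proof -
  have "V \<noteq> {}" using con connected_iff_cut[of D] pair_graphD[OF pair_graph_D] by simp
  then obtain v0 where v0: "v0 \<in> V" by blast
  define h where "h = gr (\<phi> v0) \<otimes> inv (gr v0)"
  have h: "h \<in> carrier G" using v0 graph_autsD(3)[OF \<phi>] by (simp add: h_def in_VD)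
  let ?A = "{v \<in> V. \<phi> v = act h v}"
  have "\<phi> v0 = act h v0"
    by (rule V_eqI) (use v0 h graph_autsD(3)[OF \<phi>] lab in \<open>simp_all add: h_def m_assoc in_VD\<close>)
  then have "?A \<noteq> {}" using v0 by blast
  moreover have "v \<in> ?A" if uv: "(u, v) \<in> E" and u: "u \<in> ?A" for u v
  proof -
    have V: "u \<in> V" "v \<in> V" using uv by (auto simp: E_iff)
    have "(\<phi> u, \<phi> v) \<in> E" using graph_autsD(4)[OF \<phi> V] uv by blast
    moreover have "(\<phi> u, act h v) \<in> E" using act_E_iff[OF h V] uv u by simp
    ultimately have "\<phi> v = act h v" by (rule E_lab_unique) (use lab V h in simp)
    with V show ?thesis by simp
  qed
  ultimately have "?A = V"
    using con connected_iff_cut[of D] pair_graphD[OF pair_graph_D]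
    by (metis (no_types, lifting) D_simps mem_Collect_eq subsetI)
  have "\<phi> = act h"
  proof (rule extensionalityI[OF graph_autsD(2)[OF \<phi>]])
    show "act h \<in> extensional V" by (simp add: act_def)
    show "\<phi> v = act h v" if "v \<in> V" for v using that \<open>?A = V\<close> by blast
  qed
  with h show ?thesis by blast
qed

text \<open>Every automorphism preserves the union of the fibres over \<open>A\<close>. Closure
  under set operations and neighbourhoods will allow ever smaller sets of labels to be isolated,
  down to singletons.\<close>

definition aut_invariant :: "'l set \<Rightarrow> bool" where
  "aut_invariant A \<longleftrightarrow> (\<forall>\<phi> \<in> graph_auts D. \<forall>v \<in> V. lab (\<phi> v) \<in> A \<longleftrightarrow> lab v \<in> A)"

lemma aut_invariant_Int: "aut_invariant A \<Longrightarrow> aut_invariant B \<Longrightarrow> aut_invariant (A \<inter> B)"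
  and aut_invariant_Diff: "aut_invariant A \<Longrightarrow> aut_invariant B \<Longrightarrow> aut_invariant (A - B)"
  by (simp_all add: aut_invariant_def)

text \<open>A vertex lies over this set exactly if it has a neighbour over \<open>A\<close>, a
  condition that automorphisms preserve.\<close>

lemma aut_invariant_nbrs:
  assumes A: "aut_invariant A"
  shows "aut_invariant {l. \<exists>l' \<in> A. adj l l'}"
  unfolding aut_invariant_def
proof (intro ballI)
  have nb: "lab v \<in> {l. \<exists>l' \<in> A. adj l l'} \<longleftrightarrow> (\<exists>w. (v, w) \<in> E \<and> lab w \<in> A)" if "v \<in> V" for v
    using E_step[OF that] by (auto simp: E_iff)
  fix \<phi> v assume \<phi>: "\<phi> \<in> graph_auts D" and v: "v \<in> V"
  note a = graph_autsD[OF \<phi>]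
  have "(\<exists>w. (\<phi> v, w) \<in> E \<and> lab w \<in> A) \<longleftrightarrow> (\<exists>w. (v, w) \<in> E \<and> lab w \<in> A)"
  proof
    assume "\<exists>w. (\<phi> v, w) \<in> E \<and> lab w \<in> A"
    then show "\<exists>w. (v, w) \<in> E \<and> lab w \<in> A"
      using graph_auts_E_surj[OF \<phi> v] A \<phi> unfolding aut_invariant_def by metis
  next
    assume "\<exists>w. (v, w) \<in> E \<and> lab w \<in> A"
    then obtain w where "(v, w) \<in> E" "lab w \<in> A" by blast
    moreover from this have "w \<in> V" by (simp add: E_iff)
    ultimately have "(\<phi> v, \<phi> w) \<in> E" "lab (\<phi> w) \<in> A"
      using A \<phi> v a(4) unfolding aut_invariant_def by blast+
    then show "\<exists>w. (\<phi> v, w) \<in> E \<and> lab w \<in> A" by blast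
  qed
  then show "lab (\<phi> v) \<in> {l. \<exists>l' \<in> A. adj l l'} \<longleftrightarrow> lab v \<in> {l. \<exists>l' \<in> A. adj l l'}"
    using nb v a(3) by simp
qed

text \<open>A triangle of the base lifts to a triangle exactly if its net voltage is trivial. So
  these are the labels of the vertices on triangles of \<open>D\<close>.\<close>

lemma aut_invariant_triangles:
  "aut_invariant {l. \<exists>l' l''. adj l l' \<and> adj l' l'' \<and> adj l'' l \<and> \<alpha> l l' \<otimes> \<alpha> l' l'' \<otimes> \<alpha> l'' l = \<one>}"
    (is "aut_invariant ?T")
  unfolding aut_invariant_def
proof (intro ballI)
  have tri: "lab v \<in> ?T \<longleftrightarrow> (\<exists>u w. (v, u) \<in> E \<and> (u, w) \<in> E \<and> (w, v) \<in> E)" if v: "v \<in> V" for v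
  proof
    assume "lab v \<in> ?T"
    then obtain l' l'' where l: "adj (lab v) l'" "adj l' l''" "adj l'' (lab v)"
      "\<alpha> (lab v) l' \<otimes> \<alpha> l' l'' \<otimes> \<alpha> l'' (lab v) = \<one>" by blast
    obtain u where u: "(v, u) \<in> E" "lab u = l'" using E_step[OF v l(1)] .
    then have "u \<in> V" by (simp add: E_iff)
    then obtain w where w: "(u, w) \<in> E" "lab w = l''" using E_step[of u l''] u l(2) by metis
    have "gr w \<otimes> \<alpha> l'' (lab v) = gr v \<otimes> (\<alpha> (lab v) l' \<otimes> \<alpha> l' l'' \<otimes> \<alpha> l'' (lab v))"
      using u w l(1-3) by (simp add: E_iff m_assoc volt_closed in_VD)
    then have "(w, v) \<in> E" using u w l v by (simp add: E_iff in_VD)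
    with u w show "\<exists>u w. (v, u) \<in> E \<and> (u, w) \<in> E \<and> (w, v) \<in> E" by blast
  next
    assume "\<exists>u w. (v, u) \<in> E \<and> (u, w) \<in> E \<and> (w, v) \<in> E"
    then obtain u w where e: "(v, u) \<in> E" "(u, w) \<in> E" "(w, v) \<in> E" by blast
    then have a: "adj (lab v) (lab u)" "adj (lab u) (lab w)" "adj (lab w) (lab v)"
      and g: "gr u = gr v \<otimes> \<alpha> (lab v) (lab u)" "gr w = gr u \<otimes> \<alpha> (lab u) (lab w)"
        "gr v = gr w \<otimes> \<alpha> (lab w) (lab v)"
      by (auto simp: E_iff)
    define x where "x = \<alpha> (lab v) (lab u) \<otimes> \<alpha> (lab u) (lab w) \<otimes> \<alpha> (lab w) (lab v)"
    have x: "x \<in> carrier G" using a by (simp add: x_def volt_closed)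
    have "gr v \<otimes> x = gr v \<otimes> \<alpha> (lab v) (lab u) \<otimes> \<alpha> (lab u) (lab w) \<otimes> \<alpha> (lab w) (lab v)"
      using a v by (simp add: x_def m_assoc volt_closed in_VD)
    also have "\<dots> = gr v" using g by simp
    finally have "x = \<one>" using x v in_VD(1) by simp
    then show "lab v \<in> ?T" using a unfolding x_def by blast
  qed
  fix \<phi> v assume \<phi>: "\<phi> \<in> graph_auts D" and v: "v \<in> V"
  note a = graph_autsD[OF \<phi>]
  have "(\<exists>u w. (\<phi> v, u) \<in> E \<and> (u, w) \<in> E \<and> (w, \<phi> v) \<in> E) \<longleftrightarrow>
      (\<exists>u w. (v, u) \<in> E \<and> (u, w) \<in> E \<and> (w, v) \<in> E)"
  proof
    assume "\<exists>u w. (\<phi> v, u) \<in> E \<and> (u, w) \<in> E \<and> (w, \<phi> v) \<in> E"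
    then obtain u' w' where e: "(\<phi> v, u') \<in> E" "(u', w') \<in> E" "(w', \<phi> v) \<in> E" by blast
    obtain u where u: "u' = \<phi> u" "u \<in> V" "(v, u) \<in> E" using graph_auts_E_surj[OF \<phi> v e(1)] .
    obtain w where w: "w' = \<phi> w" "w \<in> V" "(u, w) \<in> E"
      using graph_auts_E_surj[OF \<phi> u(2) e(2)[unfolded u(1)]] .
    then show "\<exists>u w. (v, u) \<in> E \<and> (u, w) \<in> E \<and> (w, v) \<in> E" using u e(3) a(4) v by blast
  next
    assume "\<exists>u w. (v, u) \<in> E \<and> (u, w) \<in> E \<and> (w, v) \<in> E"
    then show "\<exists>u w. (\<phi> v, u) \<in> E \<and> (u, w) \<in> E \<and> (w, \<phi> v) \<in> E"
      using a(4) by (metis E_iff)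
  qed
  then show "lab (\<phi> v) \<in> ?T \<longleftrightarrow> lab v \<in> ?T" using tri v a(3) by simp
qed

text \<open>Invariance of all singletons makes automorphisms preserve labels, so each is some
  \<open>act h\<close>; these permute the lifted faces.\<close>

theorem rigid_surface_realises_group:
  assumes con: "Digraph_Component.connected (with_proj D)"
    and rigid: "\<And>l. l \<in> L \<Longrightarrow> aut_invariant {l}"
  shows "pair_graph D \<and> k_vertex_connected 3 D \<and> regular_graph 3 D \<and>
    cycle_double_cover D Z \<and> Aut_graph D \<cong> G \<and> describes_polyhedral_map Z \<and>
    {graph_image \<pi> C | \<pi> C. C \<in> Z \<and> \<pi> \<in> carrier (Aut_graph D)} = Z"
proof -
  have "V \<noteq> {}" using con connected_iff_cut[of D] pair_graphD[OF pair_graph_D] by simp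
  then have L: "L \<noteq> {}" using in_VD by blast
  have "graph_auts D \<subseteq> act ` carrier G"
  proof
    fix \<phi> assume \<phi>: "\<phi> \<in> graph_auts D"
    have "lab (\<phi> v) = lab v" if "v \<in> V" for v
      using rigid[OF in_VD(2)[OF that]] \<phi> that by (auto simp: aut_invariant_def)
    with \<phi> con show "\<phi> \<in> act ` carrier G" by (intro lab_preserving_aut)
  qed
  then have auts: "graph_auts D = act ` carrier G" using act_auts by blast
  then have "G \<cong> Aut_graph D" using act_iso[OF L] by (auto simp: is_iso_def)
  then have "Aut_graph D \<cong> G" by (rule iso_sym)
  moreover have "{graph_image \<pi> C | \<pi> C. C \<in> Z \<and> \<pi> \<in> carrier (Aut_graph D)} = Z"
  proof
    show "{graph_image \<pi> C | \<pi> C. C \<in> Z \<and> \<pi> \<in> carrier (Aut_graph D)} \<subseteq> Z"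
    proof clarify
      fix \<pi> C assume "C \<in> Z" "\<pi> \<in> carrier (Aut_graph D)"
      then obtain h f v where "\<pi> = act h" "h \<in> carrier G" "C = face_cycle f v" "v \<in> V" "f \<in> fs (lab v)"
        by (auto simp: Z_def Aut_graph_def auts)
      then show "graph_image \<pi> C \<in> Z"
        using graph_image_act[of h v f] by (auto simp: Z_def intro!: exI[of _ "act h v"])
    qed
    show "Z \<subseteq> {graph_image \<pi> C | \<pi> C. C \<in> Z \<and> \<pi> \<in> carrier (Aut_graph D)}"
    proof
      fix C assume "C \<in> Z"
      then obtain f v where C: "C = face_cycle f v" "v \<in> V" "f \<in> fs (lab v)" by (auto simp: Z_def)
      then have "C = graph_image (act \<one>) C" using graph_image_act[of \<one> v f] by (simp add: act_one)
      moreover have "act \<one> \<in> carrier (Aut_graph D)" by (simp add: Aut_graph_def act_auts)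
      ultimately show "C \<in> {graph_image \<pi> C | \<pi> C. C \<in> Z \<and> \<pi> \<in> carrier (Aut_graph D)}"
        using \<open>C \<in> Z\<close> by blast
    qed
  qed
  ultimately show ?thesis
    using pair_graph_D cubic_D cycle_double_cover_Z describes_polyhedral_map_Z
      cubic_polyhedral_3_connected[OF pair_graph_D con cubic_D cycle_double_cover_Z describes_polyhedral_map_Z]
    by blast
qed

end

section \<open>A prism with a marked corner\<close>

text \<open>
  \<open>Upper j\<close> and \<open>Lower j\<close> are the ends of the rungs of the prism and \<open>Sq j\<close> is the square between
  the rungs \<open>j - 1\<close> and \<open>j\<close>.  The last rung ends in \<open>GQ\<close> and, in place of an upper end, in
  the gadget \<open>GL, GR, GX, GY, GC\<close> with the triangle \<open>GL, GR, GX\<close>; the squares at its sides are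
  \<open>Sq m\<close> and \<open>Sq 0\<close>.
\<close>

datatype label = Upper nat | Lower nat | GL | GR | GX | GY | GC | GQ

datatype face = Top | Bottom | Tri | Quad | Sq nat

definition labels :: "nat \<Rightarrow> label set" where
  "labels m = Upper ` {..<m} \<union> Lower ` {..<m} \<union> {GL, GR, GX, GY, GC, GQ}"

text \<open>Read dually, the bipyramid has apexes \<open>Top\<close> and \<open>Bottom\<close> over
  the polygon \<open>Sq 0\<close>, ..., \<open>Sq m\<close>. The subdivisions insert
  \<open>Quad\<close> into the triangle \<open>Top\<close>, \<open>Sq m\<close>,
  \<open>Sq 0\<close>, and then \<open>Tri\<close> into \<open>Top\<close>, \<open>Quad\<close>,
  \<open>Sq m\<close>.\<close>

primrec faces :: "nat \<Rightarrow> label \<Rightarrow> face set" where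
  "faces m (Upper j) = {Top, Sq j, Sq (Suc j)}"
| "faces m (Lower j) = {Bottom, Sq j, Sq (Suc j)}"
| "faces m GL = {Top, Tri, Sq m}"
| "faces m GR = {Top, Tri, Quad}"
| "faces m GX = {Tri, Quad, Sq m}"
| "faces m GY = {Top, Quad, Sq 0}"
| "faces m GC = {Quad, Sq m, Sq 0}"
| "faces m GQ = {Bottom, Sq m, Sq 0}"

lemma label_all:
  "(\<forall>l. P l) \<longleftrightarrow> (\<forall>j. P (Upper j)) \<and> (\<forall>j. P (Lower j)) \<and> P GL \<and> P GR \<and> P GX \<and> P GY \<and> P GC \<and> P GQ"
  by (metis label.exhaust)

lemma label_ex:
  "(\<exists>l. P l) \<longleftrightarrow> (\<exists>j. P (Upper j)) \<or> (\<exists>j. P (Lower j)) \<or> P GL \<or> P GR \<or> P GX \<or> P GY \<or> P GC \<or> P GQ"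
  by (metis label.exhaust)

lemma face_ex:
  "(\<exists>f. P f) \<longleftrightarrow> P Top \<or> P Bottom \<or> P Tri \<or> P Quad \<or> (\<exists>k. P (Sq k))"
  by (metis face.exhaust)

lemma in_labels [simp]:
  "Upper j \<in> labels m \<longleftrightarrow> j < m" "Lower j \<in> labels m \<longleftrightarrow> j < m"
  "GL \<in> labels m" "GR \<in> labels m" "GX \<in> labels m" "GY \<in> labels m" "GC \<in> labels m" "GQ \<in> labels m"
  by (auto simp: labels_def)

text \<open>Read off from a complete table that names, for every label and every two of its faces,
  the label across that side.\<close>

lemma faces_opposite:
  assumes m: "m \<ge> 4" and "l \<in> labels m" "f \<in> faces m l" "f' \<in> faces m l" "f \<noteq> f'"
  shows "\<exists>!l'. l' \<in> labels m \<and> l' \<noteq> l \<and> f \<in> faces m l' \<and> f' \<in> faces m l'"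
proof -
  define opp where "opp l f f' a \<longleftrightarrow>
    (\<forall>l'. l' \<in> labels m \<and> l' \<noteq> l \<and> f \<in> faces m l' \<and> f' \<in> faces m l' \<longleftrightarrow> l' = a)" for l f f' a
  have opp_sym: "opp l f f' a \<longleftrightarrow> opp l f' f a" for l f f' a by (auto simp: opp_def)
  have oppU: "opp (Upper j) Top (Sq j) (if j = 0 then GY else Upper (j - 1))"
    "opp (Upper j) Top (Sq (Suc j)) (if Suc j = m then GL else Upper (Suc j))"
    "opp (Upper j) (Sq j) (Sq (Suc j)) (Lower j)" if "j < m" for j
    using that m by (auto simp: opp_def label_all)
  have oppL: "opp (Lower j) Bottom (Sq j) (if j = 0 then GQ else Lower (j - 1))"
    "opp (Lower j) Bottom (Sq (Suc j)) (if Suc j = m then GQ else Lower (Suc j))"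
    "opp (Lower j) (Sq j) (Sq (Suc j)) (Upper j)" if "j < m" for j
    using that m by (auto simp: opp_def label_all)
  have oppG: "opp GL Top Tri GR" "opp GL Top (Sq m) (Upper (m - 1))" "opp GL Tri (Sq m) GX"
    "opp GR Top Tri GL" "opp GR Top Quad GY" "opp GR Tri Quad GX"
    "opp GX Tri Quad GR" "opp GX Tri (Sq m) GL" "opp GX Quad (Sq m) GC"
    "opp GY Top Quad GR" "opp GY Top (Sq 0) (Upper 0)" "opp GY Quad (Sq 0) GC"
    "opp GC Quad (Sq m) GX" "opp GC Quad (Sq 0) GY" "opp GC (Sq m) (Sq 0) GQ"
    "opp GQ Bottom (Sq m) (Lower (m - 1))" "opp GQ Bottom (Sq 0) (Lower 0)" "opp GQ (Sq m) (Sq 0) GC"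
    using m by (auto simp: opp_def label_all)
  \<comment> \<open>The table lists each pair of faces in one order only; \<open>opp_sym\<close>
    supplies the other.\<close>
  have ex: "\<exists>a. opp k f f' a" if "opp k p q a" "opp k p r b" "opp k q r c"
    "faces m k = {p, q, r}" "l = k" for k p q r a b c
  proof -
    have "f \<in> {p, q, r}" "f' \<in> {p, q, r}" using that assms by auto
    then have "f = p \<and> f' = q \<or> f = q \<and> f' = p \<or> f = p \<and> f' = r \<or> f = r \<and> f' = p \<or>
        f = q \<and> f' = r \<or> f = r \<and> f' = q"
      using \<open>f \<noteq> f'\<close> by auto
    then show ?thesis using that(1-3) that(1-3)[THEN opp_sym[THEN iffD1]] by blast
  qed
  have "\<exists>a. opp l f f' a"
  proof (cases l)
    case (Upper j)
    then have "j < m" using assms by simp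
    from ex[OF oppU[OF this]] Upper show ?thesis by simp
  next
    case (Lower j)
    then have "j < m" using assms by simp
    from ex[OF oppL[OF this]] Lower show ?thesis by simp
  next
    case GL
    from ex[OF oppG(1-3)] GL show ?thesis by simp
  next
    case GR
    from ex[OF oppG(4-6)] GR show ?thesis by simp
  next
    case GX
    from ex[OF oppG(7-9)] GX show ?thesis by simp
  next
    case GY
    from ex[OF oppG(10-12)] GY show ?thesis by simp
  next
    case GC
    from ex[OF oppG(13-15)] GC show ?thesis by simp
  next
    case GQ
    from ex[OF oppG(16-18)] GQ show ?thesis by simp
  qed
  then obtain a where "opp l f f' a" ..
  then show ?thesis unfolding opp_def by (intro ex1I[of _ a]) simp_all
qed

lemma faces_inj:
  assumes "m \<ge> 4" "l \<in> labels m" "l' \<in> labels m" "faces m l = faces m l'"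
  shows "l = l'"
proof -
  have mem: "f \<in> faces m l \<longleftrightarrow> f \<in> faces m l'" for f using assms(4) by simp
  show ?thesis
  proof (cases "\<exists>i j. l = Upper i \<and> l' = Upper j \<or> l = Lower i \<and> l' = Lower j")
    case True
    then obtain i j where ij: "l = Upper i \<and> l' = Upper j \<or> l = Lower i \<and> l' = Lower j" by blast
    then have "i = j" using mem[of "Sq i"] mem[of "Sq (Suc i)"] mem[of "Sq j"] by auto
    with ij show ?thesis by blast
  next
    case False
    with mem[of Top] mem[of Bottom] mem[of Tri] mem[of Quad] mem[of "Sq 0"] mem[of "Sq m"] assms(1-3)
    show ?thesis by (cases l; cases l'; simp)
  qed
qed

lemma card_faces: "m \<ge> 4 \<Longrightarrow> card (faces m l) = 3"
  by (cases l) auto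

section \<open>Adjacency of labels\<close>

abbreviation ladj :: "nat \<Rightarrow> label \<Rightarrow> label \<Rightarrow> bool" where
  "ladj m \<equiv> surface_adj (labels m) (faces m)"

lemma ladj_sym: "ladj m l l' \<longleftrightarrow> ladj m l' l"
  by (auto simp: surface_adj_def)

lemma ladj_upper:
  assumes "m \<ge> 4"
  shows "ladj m (Upper i) (Upper j) \<longleftrightarrow> i < m \<and> j < m \<and> (j = Suc i \<or> i = Suc j)"
    "ladj m (Upper i) (Lower j) \<longleftrightarrow> i < m \<and> j = i"
    "ladj m (Upper i) GL \<longleftrightarrow> Suc i = m" "ladj m (Upper i) GY \<longleftrightarrow> i = 0"
    "ladj m (Upper i) GR \<longleftrightarrow> False" "ladj m (Upper i) GX \<longleftrightarrow> False" "ladj m (Upper i) GC \<longleftrightarrow> False" "ladj m (Upper i) GQ \<longleftrightarrow> False"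
  using assms by (auto simp: surface_adj_def face_ex) (metis n_not_Suc_n)

lemma ladj_lower:
  assumes "m \<ge> 4"
  shows "ladj m (Lower i) (Lower j) \<longleftrightarrow> i < m \<and> j < m \<and> (j = Suc i \<or> i = Suc j)"
    "ladj m (Lower i) GQ \<longleftrightarrow> i = 0 \<or> Suc i = m"
    "ladj m (Lower i) GL \<longleftrightarrow> False" "ladj m (Lower i) GR \<longleftrightarrow> False" "ladj m (Lower i) GX \<longleftrightarrow> False"
    "ladj m (Lower i) GY \<longleftrightarrow> False" "ladj m (Lower i) GC \<longleftrightarrow> False"
  using assms by (auto simp: surface_adj_def face_ex)

lemma ladj_gadget:
  assumes "m \<ge> 4"
  shows "ladj m GL GR \<longleftrightarrow> True" "ladj m GL GX \<longleftrightarrow> True" "ladj m GL GY \<longleftrightarrow> False" "ladj m GL GC \<longleftrightarrow> False" "ladj m GL GQ \<longleftrightarrow> False"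
    "ladj m GR GX \<longleftrightarrow> True" "ladj m GR GY \<longleftrightarrow> True" "ladj m GR GC \<longleftrightarrow> False" "ladj m GR GQ \<longleftrightarrow> False"
    "ladj m GX GY \<longleftrightarrow> False" "ladj m GX GC \<longleftrightarrow> True" "ladj m GX GQ \<longleftrightarrow> False" "ladj m GY GC \<longleftrightarrow> True" "ladj m GY GQ \<longleftrightarrow> False" "ladj m GC GQ \<longleftrightarrow> True"
    "ladj m l l \<longleftrightarrow> False"
  using assms by (auto simp: surface_adj_def face_ex) (metis not_numeral_le_zero)

lemmas ladj_half = ladj_upper ladj_lower ladj_gadget

text \<open>Adding the reversed equations lets the simplifier decide adjacency for labels in either
  order.\<close>

lemmas ladj_iff = ladj_half ladj_half[THEN trans[OF ladj_sym]]

section \<open>Voltages on the rungs of the prism\<close>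

text \<open>\<open>a i\<close> is the voltage of rung \<open>i\<close>. By \<open>a_pair\<close> the
  squares with odd index below \<open>m\<close> lie between rungs of equal voltage; by
  \<open>a_0\<close> so does \<open>Sq 0\<close>, as the last rung has voltage
  \<open>\<one>\<close>. \<open>a_image\<close> serves to connect the cover.\<close>

locale twisted_prism = group G for G (structure) +
  fixes m :: nat and a :: "nat \<Rightarrow> 'a"
    and vtx :: "'a \<Rightarrow> label \<Rightarrow> 'v :: linorder" and gr :: "'v \<Rightarrow> 'a" and lab :: "'v \<Rightarrow> label"
  assumes finite_carrier: "finite (carrier G)"
    and m: "m \<ge> 4" "even m"
    and a_image: "a ` {..<m} = carrier G"
    and a_0: "a 0 = \<one>"
    and a_pair: "even i \<Longrightarrow> a (Suc i) = a i"
    and gr_vtx: "\<lbrakk>g \<in> carrier G; l \<in> labels m\<rbrakk> \<Longrightarrow> gr (vtx g l) = g"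
    and lab_vtx: "\<lbrakk>g \<in> carrier G; l \<in> labels m\<rbrakk> \<Longrightarrow> lab (vtx g l) = l"
begin

definition volt :: "label \<Rightarrow> label \<Rightarrow> 'a" where
  "volt l l' = (case l of
     Upper i \<Rightarrow> (case l' of Lower j \<Rightarrow> a i | _ \<Rightarrow> \<one>)
   | Lower i \<Rightarrow> (case l' of Upper j \<Rightarrow> inv (a i) | _ \<Rightarrow> \<one>)
   | _ \<Rightarrow> \<one>)"

lemmas ladj_simps [simp] = ladj_iff[OF m(1)]

lemma a_closed: "i < m \<Longrightarrow> a i \<in> carrier G"
  using a_image by blast

lemma balanced_const:
  assumes "\<And>l l'. ladj m l l' \<Longrightarrow> f \<in> faces m l \<Longrightarrow> f \<in> faces m l' \<Longrightarrow> volt l l' = \<one>"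
  shows "balanced_face G (labels m) (faces m) volt f"
  unfolding balanced_face_def by (rule bexI[of _ "\<lambda>_. \<one>"]) (use assms in auto)

text \<open>Only rungs carry nontrivial voltages, and the rungs on these faces are at most rung 0,
  trivial by \<open>a_0\<close>, and the one from \<open>GC\<close> to \<open>GQ\<close>.\<close>

lemma balanced_faces:
  "balanced_face G (labels m) (faces m) volt Top"
  "balanced_face G (labels m) (faces m) volt Bottom"
  "balanced_face G (labels m) (faces m) volt Tri"
  "balanced_face G (labels m) (faces m) volt Quad"
  "balanced_face G (labels m) (faces m) volt (Sq 0)"
proof -
  have *: "volt l l' = \<one>" if "ladj m l l'" "f \<in> faces m l" "f \<in> faces m l'"
    "f \<in> {Top, Bottom, Tri, Quad, Sq 0}" for f l l'
    using that by (cases l; cases l') (auto simp: volt_def a_0)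
  show "balanced_face G (labels m) (faces m) volt Top"
    "balanced_face G (labels m) (faces m) volt Bottom"
    "balanced_face G (labels m) (faces m) volt Tri"
    "balanced_face G (labels m) (faces m) volt Quad"
    "balanced_face G (labels m) (faces m) volt (Sq 0)"
    by (rule balanced_const, erule *, auto)+
qed

text \<open>Both rungs \<open>k - 1\<close> and \<open>k\<close> have voltage \<open>a k\<close>, so
  the potential is \<open>\<one>\<close> at the upper ends and \<open>a k\<close> at the lower
  ends.\<close>

lemma balanced_odd_square:
  assumes k: "odd k" "k < m"
  shows "balanced_face G (labels m) (faces m) volt (Sq k)"
proof -
  from k obtain i where i: "k = Suc i" "even i" by (auto elim: oddE)
  define p where "p l = (case l of Lower _ \<Rightarrow> a k | _ \<Rightarrow> \<one>)" for l
  have ak: "a k \<in> carrier G" "a i = a k" using k i a_closed a_pair by auto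
  then have "p \<in> labels m \<rightarrow> carrier G" by (auto simp: p_def split: label.split)
  moreover have "p l' = p l \<otimes> volt l l'" if "ladj m l l'" "Sq k \<in> faces m l \<inter> faces m l'" for l l'
    using that ak i k m by (cases l; cases l') (auto simp: p_def volt_def)
  ultimately show ?thesis unfolding balanced_face_def by blast
qed

sublocale voltage_surface G "labels m" "faces m" volt vtx gr lab
proof
  show "finite (carrier G)" by (rule finite_carrier)
  show "finite (labels m)" by (simp add: labels_def)
  show "volt l l' \<in> carrier G" if "ladj m l l'" for l l'
    using that by (cases l; cases l') (auto simp: volt_def a_closed)
  show "volt l' l = inv (volt l l')" if "ladj m l l'" for l l'
    using that by (cases l; cases l') (auto simp: volt_def a_closed)
  show "balanced_face G (labels m) (faces m) volt f \<or> balanced_face G (labels m) (faces m) volt f'"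
    if "l \<in> labels m" "f \<in> faces m l" "f' \<in> faces m l" "f \<noteq> f'" for l f f'
  proof -
    have "f \<in> {Top, Bottom, Tri, Quad, Sq 0} \<or> f' \<in> {Top, Bottom, Tri, Quad, Sq 0} \<or>
        (\<exists>k. odd k \<and> k < m \<and> (f = Sq k \<or> f' = Sq k))"
    \<comment> \<open>Only at an end of a rung \<open>j < m\<close> can both faces be squares other
      than \<open>Sq 0\<close>. They are then consecutive, and the odd one of the two indices is
      below \<open>m\<close> because \<open>m\<close> is even.\<close>
    proof (cases "\<exists>j < m. {f, f'} = {Sq j, Sq (Suc j)}")
      case True
      then obtain j where j: "j < m" "{f, f'} = {Sq j, Sq (Suc j)}" by blast
      have "Suc j < m" if "even j" using that j(1) m by (metis Suc_lessI even_Suc)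
      then obtain k where "k \<in> {j, Suc j}" "odd k" "k < m" using j(1) by (meson even_Suc insertCI)
      moreover from this have "f = Sq k \<or> f' = Sq k" using j(2) by (auto simp: doubleton_eq_iff)
      ultimately show ?thesis by blast
    next
      case False
      then show ?thesis using that by (cases l) (auto simp: doubleton_eq_iff)
    qed
    then show ?thesis using balanced_faces balanced_odd_square by blast
  qed
qed (use faces_opposite[OF m(1)] faces_inj[OF m(1)] card_faces[OF m(1)] gr_vtx lab_vtx in auto)

text \<open>The edges of voltage \<open>\<one>\<close> connect all vertices with the same group
  coordinate. Rung \<open>i\<close> joins layer \<open>g\<close> to layer
  \<open>g \<otimes> a i\<close>, and by \<open>a_image\<close> this reaches every layer.\<close>

lemma connected_D: "Digraph_Component.connected (with_proj D)"
proof -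
  have "\<exists>u v. (u, v) \<in> E \<and> u \<in> A \<and> v \<notin> A" if A: "A \<subseteq> V" "A \<noteq> {}" "A \<noteq> V" for A
  proof (rule ccontr)
    assume "\<not> ?thesis"
    then have closed: "u \<in> A \<longleftrightarrow> v \<in> A" if "(u, v) \<in> E" for u v
      using that sym_E by (meson symD)
    have cl: "vtx g l \<in> A \<longleftrightarrow> vtx (g \<otimes> volt l l') l' \<in> A" if "g \<in> carrier G" "ladj m l l'" for g l l'
      by (rule closed) (use that in \<open>simp add: E_vtx_iff adj_in_L volt_closed\<close>)
    have cl1: "vtx g l \<in> A \<longleftrightarrow> vtx g l' \<in> A" if "g \<in> carrier G" "ladj m l l'" "volt l l' = \<one>" for g l l'
      using cl[OF that(1,2)] that by simp
    have up: "vtx g (Upper i) \<in> A \<longleftrightarrow> vtx g (Upper 0) \<in> A" if g: "g \<in> carrier G" and "i < m" for g i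
      using \<open>i < m\<close>
    proof (induction i)
      case (Suc i)
      then show ?case using cl1[OF g, of "Upper i" "Upper (Suc i)"] by (simp add: volt_def)
    qed simp
    have low: "vtx g (Lower i) \<in> A \<longleftrightarrow> vtx g (Lower 0) \<in> A" if g: "g \<in> carrier G" and "i < m" for g i
      using \<open>i < m\<close>
    proof (induction i)
      case (Suc i)
      then show ?case using cl1[OF g, of "Lower i" "Lower (Suc i)"] by (simp add: volt_def)
    qed simp
    have fibre: "vtx g l \<in> A \<longleftrightarrow> vtx g (Upper 0) \<in> A" if g: "g \<in> carrier G" and l: "l \<in> labels m" for g l
    proof -
      note c = cl1[OF g]
      have Y: "vtx g GY \<in> A \<longleftrightarrow> vtx g (Upper 0) \<in> A" using c[of GY "Upper 0"] by (simp add: volt_def)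
      have C: "vtx g GC \<in> A \<longleftrightarrow> vtx g (Upper 0) \<in> A" using c[of GY GC] Y by (simp add: volt_def)
      have Q: "vtx g GQ \<in> A \<longleftrightarrow> vtx g (Upper 0) \<in> A" using c[of GC GQ] C by (simp add: volt_def)
      have X: "vtx g GX \<in> A \<longleftrightarrow> vtx g (Upper 0) \<in> A" using c[of GC GX] C by (simp add: volt_def)
      have L: "vtx g GL \<in> A \<longleftrightarrow> vtx g (Upper 0) \<in> A" using c[of GX GL] X by (simp add: volt_def)
      have R: "vtx g GR \<in> A \<longleftrightarrow> vtx g (Upper 0) \<in> A" using c[of GX GR] X by (simp add: volt_def)
      have L0: "vtx g (Lower 0) \<in> A \<longleftrightarrow> vtx g (Upper 0) \<in> A"
        using c[of GQ "Lower 0"] Q by (simp add: volt_def)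
      show ?thesis
      proof (cases l)
        case (Upper i)
        then show ?thesis using up[OF g, of i] l by simp
      next
        case (Lower i)
        then show ?thesis using low[OF g, of i] L0 l by simp
      qed (simp_all only: Y C Q X L R)
    qed
    have "A = V"
    proof
      obtain v where "v \<in> A" using A by blast
      then have v: "v \<in> V" "vtx (gr v) (Upper 0) \<in> A"
        using A fibre[of "gr v" "lab v"] in_VD[of v] by auto
      show "V \<subseteq> A"
      proof
        fix w assume w: "w \<in> V"
        \<comment> \<open>The rung that leads from the layer of \<open>v\<close> to that of
          \<open>w\<close> is the one whose voltage is this quotient.\<close>
        have "inv (gr v) \<otimes> gr w \<in> a ` {..<m}" using v w by (simp add: a_image in_VD)
        then obtain i where i: "i < m" "inv (gr v) \<otimes> gr w = a i" by auto
        then have "gr v \<otimes> a i = gr w"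
          using v w by (metis in_VD(1) inv_closed inv_solve_left m_closed)
        then have "vtx (gr v) (Upper i) \<in> A \<longleftrightarrow> vtx (gr w) (Lower i) \<in> A"
          using cl[of "gr v" "Upper i" "Lower i"] v i by (simp add: volt_def in_VD)
        then have "vtx (gr w) (Upper 0) \<in> A"
          using fibre[of "gr v" "Upper i"] fibre[of "gr w" "Lower i"] v w i by (simp add: in_VD)
        then show "w \<in> A" using fibre[of "gr w" "lab w"] w by (simp add: in_VD)
      qed
    qed (rule A)
    with A show False by blast
  qed
  moreover have "V \<noteq> {}" using vtx_in_V[of \<one> GQ] by auto
  ultimately show ?thesis
    using connected_iff_cut[of D] pair_graphD[OF pair_graph_D] by simp
qed

text \<open>Every label is singled out by the triangle and the adjacency relation alone: first the
  labels next to the triangle, then, column by column, all others, as the last unidentified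
  neighbour of an identified label.\<close>

lemma aut_invariant_label: "l \<in> labels m \<Longrightarrow> aut_invariant {l}"
proof -
  note Int = aut_invariant_Int and Diff = aut_invariant_Diff and N = aut_invariant_nbrs
  have 0: "aut_invariant {GL, GR, GX}"
  proof -
    have "{l. \<exists>l' l''. ladj m l l' \<and> ladj m l' l'' \<and> ladj m l'' l \<and> volt l l' \<otimes> volt l' l'' \<otimes> volt l'' l = \<one>}
      = {GL, GR, GX}"
      using m by (auto simp: set_eq_iff label_all label_ex volt_def)
    with aut_invariant_triangles show ?thesis by simp
  qed
  have "{l. \<exists>l' \<in> {GL, GR, GX}. ladj m l l'} - {GL, GR, GX} = {Upper (m - 1), GY, GC}"
    using m by (auto simp: set_eq_iff label_all)
  with Diff[OF N[OF 0] 0] have 1: "aut_invariant {Upper (m - 1), GY, GC}" by simp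
  \<comment> \<open>Of the three outer neighbours of the triangle only \<open>GY\<close> and
    \<open>GC\<close> are adjacent to each other.\<close>
  have "{l. \<exists>l' \<in> {Upper (m - 1), GY, GC}. ladj m l l'} \<inter> {Upper (m - 1), GY, GC} = {GY, GC}"
    using m by (auto simp: set_eq_iff label_all)
  with Int[OF N[OF 1] 1] have 2: "aut_invariant {GY, GC}" by simp
  have "{Upper (m - 1), GY, GC} - {GY, GC} = {Upper (m - 1)}" by auto
  with Diff[OF 1 2] have last: "aut_invariant {Upper (m - 1)}" by simp
  have "{l. \<exists>l' \<in> {GY, GC}. ladj m l l'} - {GL, GR, GX} - {GY, GC} = {Upper 0, GQ}"
    using m by (auto simp: set_eq_iff label_all)
  with Diff[OF Diff[OF N[OF 2] 0] 2] have 3: "aut_invariant {Upper 0, GQ}" by simp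
  \<comment> \<open>This breaks the tie between \<open>Upper 0\<close> and \<open>GQ\<close>, since
    only \<open>GQ\<close> is adjacent to \<open>Lower (m - 1)\<close>. By \<open>m \<ge> 4\<close>
    the labels \<open>Upper (m - 2)\<close> and \<open>Upper 1\<close> differ, so the former is not
    in the intersection.\<close>
  have "{l. \<exists>l' \<in> {Upper (m - 1)}. ladj m l l'} \<inter> {l. \<exists>l' \<in> {Upper 0, GQ}. ladj m l l'} = {Lower (m - 1)}"
    using m by (auto simp: set_eq_iff label_all)
  with Int[OF N[OF last] N[OF 3]] have 4: "aut_invariant {Lower (m - 1)}" by simp
  have "{l. \<exists>l' \<in> {Lower (m - 1)}. ladj m l l'} \<inter> {Upper 0, GQ} = {GQ}"
    using m by (auto simp: set_eq_iff label_all)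
  with Int[OF N[OF 4] 3] have Q: "aut_invariant {GQ}" by simp
  have "{Upper 0, GQ} - {GQ} = {Upper 0}" by auto
  with Diff[OF 3 Q] have U0: "aut_invariant {Upper 0}" by simp
  have "{l. \<exists>l' \<in> {GQ}. ladj m l l'} \<inter> {GY, GC} = {GC}"
    using m by (auto simp: set_eq_iff label_all)
  with Int[OF N[OF Q] 2] have C: "aut_invariant {GC}" by simp
  have "{GY, GC} - {GC} = {GY}" by auto
  with Diff[OF 2 C] have Y: "aut_invariant {GY}" by simp
  have "{l. \<exists>l' \<in> {GC}. ladj m l l'} \<inter> {GL, GR, GX} = {GX}"
    using m by (auto simp: set_eq_iff label_all)
  with Int[OF N[OF C] 0] have X: "aut_invariant {GX}" by simp
  have "{l. \<exists>l' \<in> {GY}. ladj m l l'} \<inter> {GL, GR, GX} = {GR}"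
    using m by (auto simp: set_eq_iff label_all)
  with Int[OF N[OF Y] 0] have R: "aut_invariant {GR}" by simp
  have "{GL, GR, GX} - {GR} - {GX} = {GL}" by auto
  with Diff[OF Diff[OF 0 R] X] have L: "aut_invariant {GL}" by simp
  have "{l. \<exists>l' \<in> {GQ}. ladj m l l'} \<inter> {l. \<exists>l' \<in> {Upper 0}. ladj m l l'} = {Lower 0}"
    using m by (auto simp: set_eq_iff label_all)
  with Int[OF N[OF Q] N[OF U0]] have L0: "aut_invariant {Lower 0}" by simp
  have "{l. \<exists>l' \<in> {Upper 0}. ladj m l l'} - {GY} - {Lower 0} = {Upper (Suc 0)}"
    using m by (auto simp: set_eq_iff label_all)
  with Diff[OF Diff[OF N[OF U0] Y] L0] have U1: "aut_invariant {Upper (Suc 0)}" by simp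
  have "{l. \<exists>l' \<in> {Lower 0}. ladj m l l'} - {GQ} - {Upper 0} = {Lower (Suc 0)}"
    using m by (auto simp: set_eq_iff label_all)
  with Diff[OF Diff[OF N[OF L0] Q] U0] have L1: "aut_invariant {Lower (Suc 0)}" by simp
  \<comment> \<open>Two consecutive columns are carried along, so that the next column consists of
    the third neighbours of known labels.\<close>
  have col: "aut_invariant {Upper j} \<and> aut_invariant {Lower j} \<and>
      aut_invariant {Upper (Suc j)} \<and> aut_invariant {Lower (Suc j)}" if "Suc j < m" for j
    using that
  proof (induction j)
    case 0
    then show ?case using U0 L0 U1 L1 by simp
  next
    case (Suc j)
    then have IH: "aut_invariant {Upper j}" "aut_invariant {Lower j}"
      "aut_invariant {Upper (Suc j)}" "aut_invariant {Lower (Suc j)}" by auto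
    have "{l. \<exists>l' \<in> {Upper (Suc j)}. ladj m l l'} - {Upper j} - {Lower (Suc j)} = {Upper (Suc (Suc j))}"
      using Suc.prems by (auto simp: set_eq_iff label_all)
    with Diff[OF Diff[OF N[OF IH(3)] IH(1)] IH(4)] have "aut_invariant {Upper (Suc (Suc j))}" by simp
    moreover have "{l. \<exists>l' \<in> {Lower (Suc j)}. ladj m l l'} - {Lower j} - {Upper (Suc j)} = {Lower (Suc (Suc j))}"
      using Suc.prems by (auto simp: set_eq_iff label_all)
    with Diff[OF Diff[OF N[OF IH(4)] IH(2)] IH(3)] have "aut_invariant {Lower (Suc (Suc j))}" by simp
    ultimately show ?case using IH by simp
  qed
  have "aut_invariant {Upper j} \<and> aut_invariant {Lower j}" if "j < m" for j
  proof (cases j)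
    case (Suc i)
    then show ?thesis using col[of i] that by simp
  qed (use U0 L0 in simp)
  then show "aut_invariant {l}" if "l \<in> labels m"
    using that Q C Y X R L by (cases l) auto
qed

end

section \<open>Choice of voltages and encoding of vertices as natural numbers\<close>

theorem mainTheorem1:
  fixes G :: "('a, 'b) monoid_scheme"
    and S :: "'a set"
  assumes "group G"
    and "finite (carrier G)"
    and "S \<subseteq> carrier G"
    and "generate G S = carrier G"
  shows "\<exists>(D :: nat pair_pre_digraph) (Z :: nat pair_pre_digraph set).
           pair_graph D \<and> k_vertex_connected 3 D \<and> regular_graph 3 D \<and>
           cycle_double_cover D Z \<and>
           Aut_graph D \<cong> G \<and>
           describes_polyhedral_map Z \<and>
           {graph_image \<pi> C | \<pi> C. C \<in> Z \<and> \<pi> \<in> carrier (Aut_graph D)} = Z"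
proof -
  interpret group G by fact
  obtain gs where gs: "set gs = carrier G" using finite_list[OF assms(2)] by blast
  then have gs_ne: "gs \<noteq> []" by auto
  \<comment> \<open>The leading unit gives \<open>a 0 = \<one>\<close>; as \<open>gs\<close> is
    nonempty, it also makes \<open>xs\<close> long enough for \<open>m \<ge> 4\<close>.\<close>
  define xs where "xs = \<one>\<^bsub>G\<^esub> # gs"
  define m where "m = 2 * length xs"
  \<comment> \<open>Halving the index puts each entry of \<open>xs\<close> on two consecutive rungs,
    the first with even index.\<close>
  define a where "a i = xs ! (i div 2)" for i
  have image: "a ` {..<m} = carrier G"
  proof -
    have "a ` {..<m} = set xs"
    proof
      show "a ` {..<m} \<subseteq> set xs" by (auto simp: a_def m_def intro!: nth_mem)
      show "set xs \<subseteq> a ` {..<m}"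
      proof
        fix x assume "x \<in> set xs"
        then obtain i where "i < length xs" "xs ! i = x" by (auto simp: in_set_conv_nth)
        then have "2 * i \<in> {..<m}" "a (2 * i) = x" by (simp_all add: a_def m_def)
        then show "x \<in> a ` {..<m}" by blast
      qed
    qed
    then show ?thesis using gs by (auto simp: xs_def)
  qed
  \<comment> \<open>Numberings of labels and group elements, combined by \<open>prod_encode\<close>,
    turn the vertices into natural numbers.\<close>
  obtain e :: "label \<Rightarrow> nat" where e: "inj_on e (labels m)"
    using finite_imp_inj_to_nat_seg[of "labels m"] by (auto simp: labels_def)
  obtain d :: "'a \<Rightarrow> nat" where d: "inj_on d (carrier G)"
    using finite_imp_inj_to_nat_seg[OF assms(2)] by auto
  interpret twisted_prism G m a "\<lambda>g l. prod_encode (d g, e l)"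
    "\<lambda>v. inv_into (carrier G) d (fst (prod_decode v))" "\<lambda>v. inv_into (labels m) e (snd (prod_decode v))"
  proof
    show "m \<ge> 4" using gs_ne by (cases gs) (auto simp: m_def xs_def)
    show "a (Suc i) = a i" if "even i" for i using that by (simp add: a_def)
  qed (use assms image d e in \<open>auto simp: m_def a_def xs_def\<close>)
  show ?thesis
    using rigid_surface_realises_group[OF connected_D aut_invariant_label] by blast
qed

end
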